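(* Let $A$ and $B$ be groups and let $G=A\wr B$ be their restricted wreath product. Then $G$ has property (VRC) if and only if both of the following conditions hold: (i) both $A$ and $B$ have property (VRC); (ii) either $B$ is finite or $A$ is abelian.
   Context: A subgroup $H$ of a group $K$ is a retract of $K$ if there is a homomorphism $\rho: K \to H$ which restricts to the identity map on $H$. A subgroup $H$ of a group $G$ is a virtual retract of $G$ if there exists a subgroup $K \leqslant G$ with $|G:K|<\infty$, $H \subseteq K$, and $H$ a retract of $K$. A group $G$ has property (VRC) if every cyclic subgroup of $G$ is a virtual retract of $G$. For groups $A,B$, the restricted wreath product $A\wr B$ is the semidirect product $A^B\rtimes B$, where $A^B$ is the group of all functions $f:B\to A$ with finite support under pointwise multiplication, and $b\in B$ acts by $(bfb^{-1})(x)=f(xb)$ for all $x\in B$. *)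

theory Defs
  imports "HOL-Algebra.Elementary_Groups" "HOL-Algebra.Product_Groups"
begin

definition retract_of :: "'a set \<Rightarrow> ('a, 'm) monoid_scheme \<Rightarrow> bool" where
  "retract_of H K \<longleftrightarrow>
     subgroup H K \<and> (\<exists>\<rho> \<in> hom K (K\<lparr>carrier := H\<rparr>). \<forall>h \<in> H. \<rho> h = h)"

text \<open>Finite index is expressed as finiteness of the set of cosets; \<open>card (rcosets K)\<close> would be
  \<open>0\<close> for infinite index.\<close>

definition virtual_retract_of :: "'a set \<Rightarrow> ('a, 'm) monoid_scheme \<Rightarrow> bool" where
  "virtual_retract_of H G \<longleftrightarrow>
     subgroup H G \<and>
     (\<exists>K. subgroup K G \<and> finite (rcosets\<^bsub>G\<^esub> K) \<and> H \<subseteq> K \<and> retract_of H (G\<lparr>carrier := K\<rparr>))"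

definition VRC :: "('a, 'm) monoid_scheme \<Rightarrow> bool" where
  "VRC G \<longleftrightarrow>
     (\<forall>H. subgroup H G \<and> cyclic_group (G\<lparr>carrier := H\<rparr>) \<longrightarrow> virtual_retract_of H G)"

definition semidirect_product ::
    "('n, 'k) monoid_scheme \<Rightarrow> ('b, 'm) monoid_scheme \<Rightarrow> ('b \<Rightarrow> 'n \<Rightarrow> 'n) \<Rightarrow> ('n \<times> 'b) monoid" where
  "semidirect_product N B \<phi> =
     \<lparr>carrier = carrier N \<times> carrier B,
      monoid.mult = (\<lambda>(f, b) (g, c). (f \<otimes>\<^bsub>N\<^esub> \<phi> b g, b \<otimes>\<^bsub>B\<^esub> c)),
      one = (\<one>\<^bsub>N\<^esub>, \<one>\<^bsub>B\<^esub>)\<rparr>"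

text \<open>Elements of the base group are extensional: they are \<open>undefined\<close> outside \<open>carrier B\<close>,
  so that each function on \<open>carrier B\<close> is represented exactly once.\<close>

definition base_group ::
    "('a, 'k) monoid_scheme \<Rightarrow> ('b, 'm) monoid_scheme \<Rightarrow> ('b \<Rightarrow> 'a) monoid" where
  "base_group A B = sum_group (carrier B) (\<lambda>_. A)"

definition base_action ::
    "('b, 'm) monoid_scheme \<Rightarrow> 'b \<Rightarrow> ('b \<Rightarrow> 'a) \<Rightarrow> ('b \<Rightarrow> 'a)" where
  "base_action B b f = (\<lambda>x \<in> carrier B. f (x \<otimes>\<^bsub>B\<^esub> b))"

definition restricted_wreath ::
    "('a, 'k) monoid_scheme \<Rightarrow> ('b, 'm) monoid_scheme \<Rightarrow> (('b \<Rightarrow> 'a) \<times> 'b) monoid" where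
  "restricted_wreath A B = semidirect_product (base_group A B) B (base_action B)"

lemma base_group_carrier:
  assumes "group A"
  shows "carrier (base_group A B) =
    {f \<in> carrier B \<rightarrow>\<^sub>E carrier A. finite {x \<in> carrier B. f x \<noteq> \<one>\<^bsub>A\<^esub>}}"
  unfolding base_group_def using assms by (rule carrier_sum_group)

lemma group_base_group:
  assumes "group A"
  shows "group (base_group A B)"
  unfolding base_group_def using assms by simp

lemma base_action_closed:
  assumes "group A" "group B" "b \<in> carrier B" "f \<in> carrier (base_group A B)"
  shows "base_action B b f \<in> carrier (base_group A B)"
proof -
  interpret B: group B by fact
  let ?T = "{x \<in> carrier B. f x \<noteq> \<one>\<^bsub>A\<^esub>}"
  have f: "f \<in> carrier B \<rightarrow>\<^sub>E carrier A" "finite ?T"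
    using assms(4) by (auto simp: base_group_carrier[OF assms(1)])
  have "{x \<in> carrier B. base_action B b f x \<noteq> \<one>\<^bsub>A\<^esub>} \<subseteq> (\<lambda>y. y \<otimes>\<^bsub>B\<^esub> inv\<^bsub>B\<^esub> b) ` ?T"
  proof
    fix x assume x: "x \<in> {x \<in> carrier B. base_action B b f x \<noteq> \<one>\<^bsub>A\<^esub>}"
    then have "x \<otimes>\<^bsub>B\<^esub> b \<in> ?T" using assms(3) by (auto simp: base_action_def)
    moreover have "x = (x \<otimes>\<^bsub>B\<^esub> b) \<otimes>\<^bsub>B\<^esub> inv\<^bsub>B\<^esub> b"
      using x assms(3) by (simp add: B.m_assoc)
    ultimately show "x \<in> (\<lambda>y. y \<otimes>\<^bsub>B\<^esub> inv\<^bsub>B\<^esub> b) ` ?T" by blast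
  qed
  then have "finite {x \<in> carrier B. base_action B b f x \<noteq> \<one>\<^bsub>A\<^esub>}"
    using f(2) finite_surj by blast
  moreover have "base_action B b f \<in> carrier B \<rightarrow>\<^sub>E carrier A"
    using f(1) assms(3) by (auto simp: base_action_def PiE_iff)
  ultimately show ?thesis by (simp add: base_group_carrier[OF assms(1)])
qed

lemma base_group_mult:
  "f \<otimes>\<^bsub>base_group A B\<^esub> g = (\<lambda>x \<in> carrier B. f x \<otimes>\<^bsub>A\<^esub> g x)"
  by (simp add: base_group_def sum_group_def)

lemma base_group_one: "\<one>\<^bsub>base_group A B\<^esub> = (\<lambda>x \<in> carrier B. \<one>\<^bsub>A\<^esub>)"
  by (simp add: base_group_def sum_group_def)

lemma base_action_mult:
  assumes "group B" "b \<in> carrier B"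
  shows "base_action B b (f \<otimes>\<^bsub>base_group A B\<^esub> g) =
    base_action B b f \<otimes>\<^bsub>base_group A B\<^esub> base_action B b g"
proof -
  interpret B: group B by fact
  show ?thesis using assms(2) by (auto simp: base_action_def base_group_mult)
qed

lemma base_action_compose:
  assumes "group B" "b \<in> carrier B" "c \<in> carrier B"
  shows "base_action B b (base_action B c f) = base_action B (b \<otimes>\<^bsub>B\<^esub> c) f"
proof -
  interpret B: group B by fact
  show ?thesis using assms(2,3) by (auto simp: base_action_def B.m_assoc)
qed

lemma base_action_one:
  assumes "group A" "group B" "f \<in> carrier (base_group A B)"
  shows "base_action B \<one>\<^bsub>B\<^esub> f = f"
proof -
  interpret B: group B by fact
  have "f \<in> extensional (carrier B)"
    using assms(3) by (auto simp: base_group_carrier[OF assms(1)] PiE_def)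
  then show ?thesis by (auto simp: base_action_def extensional_def)
qed

lemma group_restricted_wreath:
  assumes "group A" "group B"
  shows "group (restricted_wreath A B)"
proof -
  interpret B: group B by fact
  interpret N: group "base_group A B" by (rule group_base_group[OF assms(1)])
  note act = base_action_closed[OF assms] base_action_mult[OF assms(2)]
    base_action_compose[OF assms(2)] base_action_one[OF assms]
  show ?thesis
  proof (rule groupI)
    fix x assume "x \<in> carrier (restricted_wreath A B)"
    then obtain f b where x: "x = (f, b)" "f \<in> carrier (base_group A B)" "b \<in> carrier B"
      by (auto simp: restricted_wreath_def semidirect_product_def)
    let ?y = "(base_action B (inv\<^bsub>B\<^esub> b) (inv\<^bsub>base_group A B\<^esub> f), inv\<^bsub>B\<^esub> b)"
    have "base_action B (inv\<^bsub>B\<^esub> b) (inv\<^bsub>base_group A B\<^esub> f)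
        \<otimes>\<^bsub>base_group A B\<^esub> base_action B (inv\<^bsub>B\<^esub> b) f
      = base_action B (inv\<^bsub>B\<^esub> b) (\<one>\<^bsub>base_group A B\<^esub>)"
      using x by (simp flip: act(2))
    also have "\<dots> = \<one>\<^bsub>base_group A B\<^esub>"
      using x by (auto simp: base_action_def base_group_one)
    finally show "\<exists>y \<in> carrier (restricted_wreath A B).
        y \<otimes>\<^bsub>restricted_wreath A B\<^esub> x = \<one>\<^bsub>restricted_wreath A B\<^esub>"
      using x act(1) by (intro bexI[of _ ?y]) (auto simp: restricted_wreath_def semidirect_product_def)
  qed (auto simp: restricted_wreath_def semidirect_product_def act N.m_assoc B.m_assoc)
qed

lemma restricted_wreath_conj:
  assumes "group A" "group B" "b \<in> carrier B" "f \<in> carrier (base_group A B)"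
  shows "(\<one>\<^bsub>base_group A B\<^esub>, b) \<otimes>\<^bsub>restricted_wreath A B\<^esub> (f, \<one>\<^bsub>B\<^esub>)
      \<otimes>\<^bsub>restricted_wreath A B\<^esub> inv\<^bsub>restricted_wreath A B\<^esub> (\<one>\<^bsub>base_group A B\<^esub>, b)
    = (\<lambda>x \<in> carrier B. f (x \<otimes>\<^bsub>B\<^esub> b), \<one>\<^bsub>B\<^esub>)"
proof -
  interpret B: group B by fact
  interpret N: group "base_group A B" by (rule group_base_group[OF assms(1)])
  interpret W: group "restricted_wreath A B" by (rule group_restricted_wreath[OF assms(1,2)])
  let ?N1 = "\<one>\<^bsub>base_group A B\<^esub>"
  have cl: "(?N1, b) \<in> carrier (restricted_wreath A B)"
      "(f, \<one>\<^bsub>B\<^esub>) \<in> carrier (restricted_wreath A B)"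
      "(base_action B b f, \<one>\<^bsub>B\<^esub>) \<in> carrier (restricted_wreath A B)"
    using assms base_action_closed[OF assms]
    by (auto simp: restricted_wreath_def semidirect_product_def)
  have "(?N1, b) \<otimes>\<^bsub>restricted_wreath A B\<^esub> (f, \<one>\<^bsub>B\<^esub>)
      = (base_action B b f, \<one>\<^bsub>B\<^esub>) \<otimes>\<^bsub>restricted_wreath A B\<^esub> (?N1, b)"
    using assms base_action_closed[OF assms] base_action_one[OF assms(1,2) N.one_closed]
    by (simp add: restricted_wreath_def semidirect_product_def)
  then show ?thesis
    using cl by (simp add: W.m_assoc flip: base_action_def)
qed

end

theory Submission
  imports Defs "HOL-Algebra.Free_Abelian_Groups"
begin

text \<open>
  A cyclic subgroup generated by \<open>g\<close> is a virtual retract iff \<open>g\<close> is visible in a suitable finite-index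
  subgroup \<open>K\<close>: a torsion element (and its nontrivial powers) must avoid some \<open>K\<close>, and an element of
  infinite order must have a power in some \<open>K\<close> with nonzero image under a homomorphism \<open>K \<rightarrow> \<int>\<close>.
  Unlike virtual retractions, these conditions pull back along homomorphisms defined on subgroups
  of finite index.

  They pass from the wreath product to \<open>A\<close> and \<open>B\<close>, which embed in it. If \<open>B\<close> is infinite, every normal
  subgroup of finite index contains some \<open>b \<noteq> 1\<close> of \<open>B\<close>; modulo this subgroup, the copies of \<open>A\<close> at the
  coordinates \<open>1\<close> and \<open>b\<^sup>-\<^sup>1\<close> coincide although they commute, so all commutators of the first
  copy lie in it. Residual finiteness then forces \<open>A\<close> to be abelian.

  Conversely, an element with nontrivial (or nontorsion) \<open>B\<close>-part is treated by projecting to \<open>B\<close>.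
  Otherwise, after passing to a power, it is a function \<open>f\<close> of finite support, and one uses a
  homomorphism to \<open>A\<close> from a subgroup of finite index that sends \<open>f\<close> to \<open>f x\<close>: evaluation on the base
  group if \<open>B\<close> is finite, and the product over a coset of a small finite-index subgroup \<open>M\<close> of \<open>B\<close> if
  \<open>A\<close> is abelian.
\<close>

section \<open>Subgroups of finite index\<close>

definition finite_index :: "'a set \<Rightarrow> ('a, 'm) monoid_scheme \<Rightarrow> bool" where
  "finite_index K G \<longleftrightarrow> subgroup K G \<and> finite (rcosets\<^bsub>G\<^esub> K)"

context group
begin

lemma inv_mult_cancel_left:
  assumes "x \<in> carrier G" "y \<in> carrier G"
  shows "inv x \<otimes> (x \<otimes> y) = y" "x \<otimes> (inv x \<otimes> y) = y"
  using assms by (simp_all flip: m_assoc)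

text \<open>Rewriting to right-associated words and cancelling adjacent inverses settles the word
  identities below.\<close>

lemmas word_simps = m_assoc inv_mult_group inv_mult_cancel_left

lemma same_rcoset:
  assumes "subgroup K G" "x \<in> carrier G" "y \<in> carrier G"
  shows "K #> x = K #> y \<longleftrightarrow> x \<otimes> inv y \<in> K"
  using assms by (metis repr_independence rcos_self subgroup.rcos_module_imp subgroup.rcos_module_rev is_group)

text \<open>Elements of \<open>L\<close> with equal \<open>q\<close> lie in one right coset of
  \<open>K\<close>, so a finite image of \<open>q\<close> means that \<open>L\<close> meets finitely
  many such cosets. Splitting off a representative of the coset of \<open>L\<close> carries this
  over to all of \<open>G\<close>.\<close>

lemma finite_index_classI:
  assumes L: "finite_index L G" and K: "subgroup K G" and fin: "finite (q ` L)"
    and q: "\<And>x y. \<lbrakk>x \<in> L; y \<in> L; q x = q y\<rbrakk> \<Longrightarrow> x \<otimes> inv y \<in> K"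
  shows "finite_index K G"
proof -
  have sL: "subgroup L G" and fL: "finite (rcosets L)"
    using L by (auto simp: finite_index_def)
  define r where "r C = (SOME x. x \<in> C)" for C :: "'a set"
  have r: "r (L #> x) \<in> carrier G" "x \<otimes> inv (r (L #> x)) \<in> L" if "x \<in> carrier G" for x
  proof -
    have "x \<in> L #> x" using that sL by (rule rcos_self)
    then have *: "r (L #> x) \<in> L #> x" unfolding r_def by (rule someI)
    then show c: "r (L #> x) \<in> carrier G"
      using r_coset_subset_G[of L x] sL subgroup.subset that by blast
    show "x \<otimes> inv (r (L #> x)) \<in> L"
      using repr_independence[OF * that sL] same_rcoset[OF sL that c] by simp
  qed
  \<comment> \<open>The label of \<open>x\<close> is its coset of \<open>L\<close> together with the
    \<open>q\<close>-value of its \<open>L\<close>-part. There are finitely many labels, and equal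
    labels will force equal cosets of \<open>K\<close>.\<close>
  define c where "c x = (L #> x, q (x \<otimes> inv (r (L #> x))))" for x
  have "c ` carrier G \<subseteq> (rcosets L) \<times> q ` L"
    using r by (auto simp: c_def RCOSETS_def)
  then have finc: "finite (c ` carrier G)"
    using fin fL by (meson finite_SigmaI finite_subset)
  have "K #> x = K #> y" if "x \<in> carrier G" "y \<in> carrier G" "c x = c y" for x y
  proof -
    let ?r = "r (L #> x)"
    have eq: "L #> x = L #> y" and *: "q (x \<otimes> inv ?r) = q (y \<otimes> inv ?r)"
      using that(3) by (auto simp: c_def)
    have "(x \<otimes> inv ?r) \<otimes> inv (y \<otimes> inv ?r) \<in> K"
      using q[OF _ _ *] r[OF that(1)] r[OF that(2)] eq by simp
    moreover have "(x \<otimes> inv ?r) \<otimes> inv (y \<otimes> inv ?r) = x \<otimes> inv y"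
      using that(1,2) r[OF that(1)] by (simp add: word_simps)
    ultimately show ?thesis using same_rcoset[OF K] that by simp
  qed
  note cls = this
  \<comment> \<open>The map to cosets of \<open>K\<close> is constant on the fibres of
    \<open>c\<close>, so it factors through the finite set of labels by a choice of
    preimages.\<close>
  have "(\<lambda>x. K #> x) ` carrier G = (\<lambda>z. K #> inv_into (carrier G) c z) ` c ` carrier G"
    unfolding image_image
    by (intro image_cong refl cls) (auto simp: f_inv_into_f intro: inv_into_into)
  then have "finite ((\<lambda>x. K #> x) ` carrier G)" using finc by simp
  moreover have "rcosets K = (\<lambda>x. K #> x) ` carrier G" by (auto simp: RCOSETS_def)
  ultimately show ?thesis using K by (simp add: finite_index_def)
qed

lemma finite_index_carrier: "finite_index (carrier G) G"
proof -
  have "rcosets (carrier G) \<subseteq> {carrier G}"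
    by (auto simp: RCOSETS_def coset_join2 subgroup_self)
  then show ?thesis by (auto simp: finite_index_def subgroup_self intro: finite_subset)
qed

lemma finite_index_finite_carrier:
  assumes "finite (carrier G)" "subgroup K G"
  shows "finite_index K G"
proof (rule finite_index_classI[OF finite_index_carrier assms(2), where q = "\<lambda>x. x"])
  show "x \<otimes> inv y \<in> K" if "x \<in> carrier G" "y \<in> carrier G" "x = y" for x y
    using that subgroup.one_closed[OF assms(2)] by simp
qed (use assms in simp)

lemma finite_index_mono:
  assumes "finite_index L G" "subgroup K G" "L \<subseteq> K"
  shows "finite_index K G"
proof (rule finite_index_classI[OF assms(1,2), where q = "\<lambda>_. ()"])
  fix x y assume "x \<in> L" "y \<in> L"
  then show "x \<otimes> inv y \<in> K"
    using assms by (auto intro: subgroup.m_closed subgroup.m_inv_closed)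
qed auto

lemma subgroup_hom_preimage:
  assumes L: "subgroup L G" and A: "group A" and f: "f \<in> hom (G\<lparr>carrier := L\<rparr>) A"
    and D: "subgroup D A"
  shows "subgroup {x \<in> L. f x \<in> D} G"
    and "x \<in> L \<Longrightarrow> f (inv x) = inv\<^bsub>A\<^esub> f x"
proof -
  interpret A: group A by fact
  interpret D: subgroup D A by fact
  interpret L: subgroup L G by fact
  interpret f: group_hom "G\<lparr>carrier := L\<rparr>" A f
    using L A f by (simp add: group_hom_def group_hom_axioms_def subgroup_imp_group)
  have i: "f (inv x) = inv\<^bsub>A\<^esub> f x" if "x \<in> L" for x
    using f.hom_inv[of x] m_inv_consistent[OF L that] that by simp
  then show "x \<in> L \<Longrightarrow> f (inv x) = inv\<^bsub>A\<^esub> f x" .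
  show "subgroup {x \<in> L. f x \<in> D} G"
  proof
    show "\<one> \<in> {x \<in> L. f x \<in> D}" using f.hom_one by simp
  next
    fix x y assume "x \<in> {x \<in> L. f x \<in> D}" "y \<in> {x \<in> L. f x \<in> D}"
    then show "x \<otimes> y \<in> {x \<in> L. f x \<in> D}" using f.hom_mult[of x y] by simp
  qed (auto simp: i)
qed

text \<open>The coset of \<open>D\<close> containing \<open>f x\<close> serves as the class
  invariant on \<open>L\<close>.\<close>

lemma finite_index_hom_preimage:
  assumes L: "finite_index L G" and A: "group A" and f: "f \<in> hom (G\<lparr>carrier := L\<rparr>) A"
    and D: "finite_index D A"
  shows "finite_index {x \<in> L. f x \<in> D} G"
proof -
  have sL: "subgroup L G" and sD: "subgroup D A" and fD: "finite (rcosets\<^bsub>A\<^esub> D)"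
    using L D by (auto simp: finite_index_def)
  note pre = subgroup_hom_preimage[OF sL A f sD]
  have cl: "f x \<in> carrier A" if "x \<in> L" for x using f that by (auto simp: hom_def)
  show ?thesis
  proof (rule finite_index_classI[OF L pre(1), where q = "\<lambda>x. D #>\<^bsub>A\<^esub> f x"])
    have "(\<lambda>x. D #>\<^bsub>A\<^esub> f x) ` L \<subseteq> rcosets\<^bsub>A\<^esub> D"
      using cl by (auto simp: RCOSETS_def)
    then show "finite ((\<lambda>x. D #>\<^bsub>A\<^esub> f x) ` L)" using fD finite_subset by blast
  next
    fix x y assume xy: "x \<in> L" "y \<in> L" "D #>\<^bsub>A\<^esub> f x = D #>\<^bsub>A\<^esub> f y"
    then have "f x \<otimes>\<^bsub>A\<^esub> inv\<^bsub>A\<^esub> f y \<in> D"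
      using group.same_rcoset[OF A sD] cl by blast
    moreover have "x \<otimes> inv y \<in> L" "inv y \<in> L"
      using sL xy by (auto intro: subgroup.m_closed subgroup.m_inv_closed)
    moreover have "f (x \<otimes> inv y) = f x \<otimes>\<^bsub>A\<^esub> f (inv y)"
      using f xy \<open>inv y \<in> L\<close> by (auto simp: hom_def)
    ultimately show "x \<otimes> inv y \<in> {x \<in> L. f x \<in> D}"
      using pre(2)[OF xy(2)] by simp
  qed
qed

lemma finite_index_Int:
  assumes "finite_index L G" "finite_index K G"
  shows "finite_index (L \<inter> K) G"
proof -
  \<comment> \<open>The intersection is the preimage of \<open>K\<close> under the inclusion of
    \<open>L\<close>.\<close>
  have "(\<lambda>x. x) \<in> hom (G\<lparr>carrier := L\<rparr>) G"
    using assms(1) by (auto simp: hom_def finite_index_def subgroup.mem_carrier)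
  from finite_index_hom_preimage[OF assms(1) is_group this assms(2)]
  show ?thesis by (simp add: Int_def)
qed

lemma finite_index_avoid_finite:
  assumes "finite S" "\<And>s. s \<in> S \<Longrightarrow> \<exists>K. finite_index K G \<and> s \<notin> K"
  shows "\<exists>K. finite_index K G \<and> K \<inter> S = {}"
  using assms
proof (induction S rule: finite_induct)
  case empty
  then show ?case using finite_index_carrier by auto
next
  case (insert s S)
  obtain K where "finite_index K G" "K \<inter> S = {}"
    using insert.IH insert.prems by blast
  moreover obtain L where "finite_index L G" "s \<notin> L"
    using insert.prems by blast
  ultimately show ?case using finite_index_Int[of K L] by (intro exI[of _ "K \<inter> L"]) auto
qed

lemma finite_index_normal_core:
  assumes K: "finite_index K G"
  obtains N where "finite_index N G" "N \<lhd> G" "N \<subseteq> K"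
proof \<comment> \<open>\<open>N\<close> is the kernel of the action of \<open>G\<close> on the cosets of \<open>K\<close>\<close>
  let ?N = "{x \<in> carrier G. \<forall>g \<in> carrier G. g \<otimes> x \<otimes> inv g \<in> K}"
  have sK: "subgroup K G" and fK: "finite (rcosets K)"
    using K by (auto simp: finite_index_def)
  interpret K: subgroup K G by fact
  have sN: "subgroup ?N G"
  proof
    fix x y assume x: "x \<in> ?N" and y: "y \<in> ?N"
    have "g \<otimes> (x \<otimes> y) \<otimes> inv g \<in> K" if g: "g \<in> carrier G" for g
    proof -
      have "(g \<otimes> x \<otimes> inv g) \<otimes> (g \<otimes> y \<otimes> inv g) = g \<otimes> (x \<otimes> y) \<otimes> inv g"
        using x y g by (simp add: word_simps)
      then show ?thesis using K.m_closed[of "g \<otimes> x \<otimes> inv g" "g \<otimes> y \<otimes> inv g"] x y g by simp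
    qed
    then show "x \<otimes> y \<in> ?N" using x y by simp
  next
    fix x assume x: "x \<in> ?N"
    have "g \<otimes> inv x \<otimes> inv g \<in> K" if g: "g \<in> carrier G" for g
    proof -
      have "inv (g \<otimes> x \<otimes> inv g) = g \<otimes> inv x \<otimes> inv g"
        using x g by (simp add: word_simps)
      then show ?thesis using K.m_inv_closed[of "g \<otimes> x \<otimes> inv g"] x g by simp
    qed
    then show "inv x \<in> ?N" using x by simp
  qed auto
  show "finite_index ?N G"
  proof (rule finite_index_classI[OF finite_index_carrier sN,
        where q = "\<lambda>x. restrict (\<lambda>C. C #> x) (rcosets K)"])
    have "(\<lambda>x. restrict (\<lambda>C. C #> x) (rcosets K)) ` carrier G
        \<subseteq> rcosets K \<rightarrow>\<^sub>E rcosets K"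
      by (force simp: RCOSETS_def coset_mult_assoc K.subset)
    then show "finite ((\<lambda>x. restrict (\<lambda>C. C #> x) (rcosets K)) ` carrier G)"
      using fK finite_PiE finite_subset by (metis (no_types, lifting))
  next
    fix x y assume xy: "x \<in> carrier G" "y \<in> carrier G"
      "restrict (\<lambda>C. C #> x) (rcosets K) = restrict (\<lambda>C. C #> y) (rcosets K)"
    have "g \<otimes> (x \<otimes> inv y) \<otimes> inv g \<in> K" if g: "g \<in> carrier G" for g
    proof -
      have "K #> g \<in> rcosets K" using g by (auto simp: RCOSETS_def)
      then have "K #> g #> x = K #> g #> y" using xy(3) by (metis restrict_apply')
      then have "K #> (g \<otimes> x) = K #> (g \<otimes> y)"
        using g xy by (simp add: coset_mult_assoc K.subset)
      then have "(g \<otimes> x) \<otimes> inv (g \<otimes> y) \<in> K"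
        using same_rcoset[OF sK] g xy by simp
      then show ?thesis using g xy by (simp add: word_simps)
    qed
    then show "x \<otimes> inv y \<in> ?N" using xy by simp
  qed
  show "?N \<lhd> G"
  proof (rule normal_invI[OF sN])
    fix x h assume x: "x \<in> carrier G" and h: "h \<in> ?N"
    have "g \<otimes> (x \<otimes> h \<otimes> inv x) \<otimes> inv g \<in> K" if g: "g \<in> carrier G" for g
    proof -
      have "g \<otimes> (x \<otimes> h \<otimes> inv x) \<otimes> inv g = (g \<otimes> x) \<otimes> h \<otimes> inv (g \<otimes> x)"
        using x h g by (simp add: word_simps)
      then show ?thesis using h x g by simp
    qed
    then show "x \<otimes> h \<otimes> inv x \<in> ?N" using x h by simp
  qed
  show "?N \<subseteq> K"
    by (auto dest!: bspec[OF _ one_closed])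
qed

text \<open>By pigeonhole two different powers of \<open>x\<close> share a coset of
  \<open>N\<close>; the difference of their exponents serves as \<open>n\<close>.\<close>

lemma finite_index_pow:
  assumes N: "finite_index N G" and x: "x \<in> carrier G"
  obtains n :: nat where "n > 0" "x [^] n \<in> N"
proof -
  have sN: "subgroup N G" using N by (simp add: finite_index_def)
  have "finite (range (\<lambda>n::nat. N #> x [^] n))"
    using N x by (auto simp: finite_index_def RCOSETS_def elim!: finite_subset[rotated])
  then have "\<not> inj (\<lambda>n::nat. N #> x [^] n)" using finite_imageD infinite_UNIV_nat by blast
  then obtain i j :: nat where ij: "i < j" "N #> x [^] j = N #> x [^] i"
    unfolding inj_def by (metis linorder_neqE_nat)
  then have "x [^] j \<otimes> inv (x [^] i) \<in> N" using same_rcoset[OF sN] x by simp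
  moreover have "x [^] j \<otimes> inv (x [^] i) = x [^] (j - i)"
    using x ij by (metis inv_solve_right' le_add_diff_inverse2 less_imp_le nat_pow_closed nat_pow_mult)
  ultimately show ?thesis using that[of "j - i"] ij by simp
qed

end

section \<open>Virtual retracts onto cyclic subgroups\<close>

definition torsion :: "('a, 'm) monoid_scheme \<Rightarrow> 'a \<Rightarrow> bool" where
  "torsion G g \<longleftrightarrow> (\<exists>n::nat. n > 0 \<and> g [^]\<^bsub>G\<^esub> n = \<one>\<^bsub>G\<^esub>)"

definition separated :: "('a, 'm) monoid_scheme \<Rightarrow> 'a \<Rightarrow> bool" where
  "separated G g \<longleftrightarrow> (\<exists>K. finite_index K G \<and> g \<notin> K)"

text \<open>The exponent allows \<open>g\<close> itself to lie outside \<open>K\<close>. In a group,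
  \<open>\<phi>\<close> vanishes at the identity, so a witness has \<open>n > 0\<close> and
  \<open>g\<close> has infinite order.\<close>

definition detected :: "('a, 'm) monoid_scheme \<Rightarrow> 'a \<Rightarrow> bool" where
  "detected G g \<longleftrightarrow> (\<exists>K. finite_index K G \<and>
     (\<exists>\<phi> \<in> hom (G\<lparr>carrier := K\<rparr>) integer_group. \<exists>n::nat. g [^]\<^bsub>G\<^esub> n \<in> K \<and> \<phi> (g [^]\<^bsub>G\<^esub> n) \<noteq> 0))"

abbreviation powers :: "('a, 'm) monoid_scheme \<Rightarrow> 'a \<Rightarrow> 'a set" where
  "powers G g \<equiv> range (\<lambda>n::int. g [^]\<^bsub>G\<^esub> n)"

context group
begin

lemma powers_subgroup:
  assumes "g \<in> carrier G"
  shows "subgroup (powers G g) G" "g \<in> powers G g"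
proof -
  show "subgroup (powers G g) G"
  proof
    fix x assume "x \<in> powers G g"
    then obtain n :: int where "x = g [^] n" by auto
    then have "inv x = g [^] (- n)" using assms by (simp add: int_pow_neg)
    then show "inv x \<in> powers G g" by simp
  qed (use assms in \<open>auto simp flip: int_pow_mult intro: range_eqI[of _ _ "0::int"]\<close>)
  show "g \<in> powers G g" using assms by (auto intro: range_eqI[of _ _ "1::int"])
qed

lemma VRC_iff_powers:
  "VRC G \<longleftrightarrow> (\<forall>g \<in> carrier G. virtual_retract_of (powers G g) G)"
proof -
  have "cyclic_group (G\<lparr>carrier := H\<rparr>) \<longleftrightarrow> (\<exists>g \<in> H. H = powers G g)" if H: "subgroup H G" for H
  proof -
    interpret H: group "G\<lparr>carrier := H\<rparr>" using H by (rule subgroup_imp_group)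
    have "g [^]\<^bsub>G\<lparr>carrier := H\<rparr>\<^esub> n = g [^] n" if "g \<in> H" for g and n :: int
      using int_pow_consistent[OF H that] by simp
    then show ?thesis by (simp add: H.cyclic_group)
  qed
  then show ?thesis
    unfolding VRC_def by (metis powers_subgroup subgroup.mem_carrier)
qed

lemma torsion_finite_powers:
  assumes "torsion G g" "g \<in> carrier G"
  shows "finite (powers G g)" "x \<in> powers G g \<Longrightarrow> torsion G x"
proof -
  obtain n :: nat where n: "n > 0" "g [^] n = \<one>" using assms by (auto simp: torsion_def)
  have "g [^] j = g [^] (j mod int n)" for j :: int
  proof -
    have "g [^] j = g [^] (int n * (j div int n) + j mod int n)" by simp
    also have "\<dots> = (g [^] int n) [^] (j div int n) \<otimes> g [^] (j mod int n)"
      using assms by (simp only: int_pow_mult int_pow_pow)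
    finally show ?thesis using n assms by (simp add: int_pow_int)
  qed
  then have "powers G g \<subseteq> (\<lambda>j::int. g [^] j) ` {0..<int n}"
    using n by (metis atLeastLessThan_iff image_subsetI imageI of_nat_0_less_iff pos_mod_bound pos_mod_sign)
  then show "finite (powers G g)" by (rule finite_subset) simp
  show "torsion G x" if "x \<in> powers G g"
  proof -
    obtain j :: int where j: "x = g [^] j" using \<open>x \<in> powers G g\<close> by auto
    have "x [^] n = (g [^] n) [^] j"
      using assms j by (simp add: int_pow_pow mult.commute flip: int_pow_int)
    then show ?thesis using n by (auto simp: torsion_def)
  qed
qed

lemma int_pow_eq_one_nontorsion:
  assumes "\<not> torsion G g" "g \<in> carrier G" "g [^] (j::int) = \<one>"
  shows "j = 0"
proof (rule ccontr)
  assume "j \<noteq> 0"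
  have "g [^] \<bar>j\<bar> = \<one>" using assms by (cases "j \<ge> 0") (auto simp: int_pow_neg)
  then have "g [^] nat \<bar>j\<bar> = \<one>" by (simp flip: int_pow_int)
  moreover have "nat \<bar>j\<bar> > 0" using \<open>j \<noteq> 0\<close> by simp
  ultimately show False using assms(1) unfolding torsion_def by blast
qed

lemma int_pow_inject_nontorsion:
  assumes "\<not> torsion G g" "g \<in> carrier G" "g [^] (i::int) = g [^] j"
  shows "i = j"
proof -
  have "g [^] (i - j) = \<one>" using assms(2,3) by (simp add: int_pow_diff)
  then show ?thesis using int_pow_eq_one_nontorsion[OF assms(1,2)] by fastforce
qed

text \<open>Since \<open>H\<close> normalises \<open>N\<close> and meets it trivially, the product
  \<open>N H\<close> is semidirect. Projection to \<open>H\<close> along \<open>N\<close> is the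
  retraction, and \<open>N H\<close> has finite index because it contains \<open>M\<close>.\<close>

lemma virtual_retractI:
  assumes H: "subgroup H G" and N: "subgroup N G"
    and conj: "\<And>h n. \<lbrakk>h \<in> H; n \<in> N\<rbrakk> \<Longrightarrow> h \<otimes> n \<otimes> inv h \<in> N"
    and triv: "N \<inter> H \<subseteq> {\<one>}"
    and M: "finite_index M G" and cover: "\<And>x. x \<in> M \<Longrightarrow> \<exists>h \<in> H. x \<otimes> inv h \<in> N"
  shows "virtual_retract_of H G"
proof -
  interpret H: subgroup H G by fact
  interpret N: subgroup N G by fact
  \<comment> \<open>\<open>?R k h\<close> says that \<open>h\<close> is the
    \<open>H\<close>-component in a factorisation \<open>k = n h\<close> with \<open>n\<close> in
    \<open>N\<close>.\<close>
  let ?R = "\<lambda>k h. h \<in> H \<and> k \<otimes> inv h \<in> N"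
  define K where "K = {k \<in> carrier G. \<exists>h. ?R k h}"
  have uniq: "h = h'" if "?R k h" "?R k h'" "k \<in> carrier G" for k h h'
  proof -
    have G: "h \<in> carrier G" "h' \<in> carrier G" using that by auto
    have "inv (k \<otimes> inv h) \<otimes> (k \<otimes> inv h') = h \<otimes> inv h'"
      using that(3) G by (simp add: word_simps)
    then have "h \<otimes> inv h' \<in> N \<inter> H"
      using that N.m_closed[OF N.m_inv_closed, of "k \<otimes> inv h" "k \<otimes> inv h'"] by simp
    then have "h \<otimes> inv h' = \<one>" using triv by auto
    then show ?thesis using G by (metis inv_closed inv_equality inv_inv)
  qed
  have mult: "?R (k \<otimes> k') (h \<otimes> h')"
    if "?R k h" "?R k' h'" "k \<in> carrier G" "k' \<in> carrier G" for k k' h h'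
  proof -
    have G: "h \<in> carrier G" "h' \<in> carrier G" using that by auto
    \<comment> \<open>With \<open>k = n h\<close> and \<open>k' = n' h'\<close> this is
      \<open>k k' = n (h n' h^-1) (h h')\<close>; the middle factor stays in \<open>N\<close>
      because \<open>H\<close> normalises \<open>N\<close>.\<close>
    have "(k \<otimes> inv h) \<otimes> (h \<otimes> (k' \<otimes> inv h') \<otimes> inv h) = k \<otimes> k' \<otimes> inv (h \<otimes> h')"
      using that(3,4) G by (simp add: word_simps)
    then show ?thesis
      using that conj[of h "k' \<otimes> inv h'"] N.m_closed[of "k \<otimes> inv h" "h \<otimes> (k' \<otimes> inv h') \<otimes> inv h"]
      by simp
  qed
  have inv: "?R (inv k) (inv h)" if "?R k h" "k \<in> carrier G" for k h
  proof -
    have G: "h \<in> carrier G" using that by auto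
    have "inv h \<otimes> inv (k \<otimes> inv h) \<otimes> inv (inv h) = inv k \<otimes> inv (inv h)"
      using that(2) G by (simp add: word_simps)
    then show ?thesis using that conj[of "inv h" "inv (k \<otimes> inv h)"] by simp
  qed
  have self: "?R h h" if "h \<in> H" for h using that by simp
  have sK: "subgroup K G"
  proof
    show "\<one> \<in> K" unfolding K_def using self[OF H.one_closed] one_closed by blast
  next
    fix x y assume "x \<in> K" "y \<in> K"
    then obtain h h' where *: "?R x h" "?R y h'" "x \<in> carrier G" "y \<in> carrier G"
      unfolding K_def by blast
    show "x \<otimes> y \<in> K" unfolding K_def using mult[OF *] * by blast
  next
    fix x assume "x \<in> K"
    then obtain h where *: "?R x h" "x \<in> carrier G" unfolding K_def by blast
    show "inv x \<in> K" unfolding K_def using inv[OF *] * by blast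
  qed (auto simp: K_def)
  have "M \<subseteq> K"
    unfolding K_def using cover M subgroup.subset unfolding finite_index_def by blast
  then have fK: "finite_index K G" by (rule finite_index_mono[OF M sK])
  define \<rho> where "\<rho> k = (THE h. ?R k h)" for k
  have \<rho>: "\<rho> k = h" if "?R k h" "k \<in> carrier G" for k h
    unfolding \<rho>_def using that uniq by blast
  have "H \<subseteq> K" using self by (auto simp: K_def)
  moreover have "\<rho> \<in> hom (G\<lparr>carrier := K\<rparr>) (G\<lparr>carrier := H\<rparr>)"
  proof (rule homI)
    fix x y assume "x \<in> carrier (G\<lparr>carrier := K\<rparr>)" "y \<in> carrier (G\<lparr>carrier := K\<rparr>)"
    then obtain h h' where *: "?R x h" "?R y h'" and xy: "x \<in> carrier G" "y \<in> carrier G"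
      by (auto simp: K_def)
    show "\<rho> (x \<otimes>\<^bsub>G\<lparr>carrier := K\<rparr>\<^esub> y) = \<rho> x \<otimes>\<^bsub>G\<lparr>carrier := H\<rparr>\<^esub> \<rho> y"
      using \<rho>[OF mult[OF * xy]] \<rho>[OF *(1) xy(1)] \<rho>[OF *(2) xy(2)] xy by simp
  next
    fix x assume "x \<in> carrier (G\<lparr>carrier := K\<rparr>)"
    then obtain h where *: "?R x h" "x \<in> carrier G" by (auto simp: K_def)
    show "\<rho> x \<in> carrier (G\<lparr>carrier := H\<rparr>)" using \<rho>[OF *] *(1) by simp
  qed
  moreover have "\<forall>h \<in> H. \<rho> h = h" using \<rho> self by simp
  ultimately have "retract_of H (G\<lparr>carrier := K\<rparr>)"
    using subgroup_incl[OF H sK] unfolding retract_of_def by auto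
  then show ?thesis
    using fK H \<open>H \<subseteq> K\<close> unfolding virtual_retract_of_def finite_index_def by blast
qed

end

lemma hom_pow_integer_group:
  assumes "group G" "f \<in> hom G integer_group" "x \<in> carrier G"
  shows "f (x [^]\<^bsub>G\<^esub> (n::nat)) = int n * f x" "f (x [^]\<^bsub>G\<^esub> (j::int)) = j * f x"
proof -
  interpret f: group_hom G integer_group f
    using assms by (simp add: group_hom_def group_hom_axioms_def)
  show "f (x [^]\<^bsub>G\<^esub> n) = int n * f x" "f (x [^]\<^bsub>G\<^esub> j) = j * f x"
    using f.hom_nat_pow f.hom_int_pow assms(3) by simp_all
qed

section \<open>Criteria for cyclic subgroups to be virtual retracts\<close>

context group
begin

text \<open>The finitely many nontrivial powers can be avoided by one subgroup of finite index. Its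
  normal core \<open>N\<close> is a complement of the powers in their product; \<open>N\<close> also
  serves as \<open>M\<close>, with identity component.\<close>

lemma torsion_virtual_retract:
  assumes g: "g \<in> carrier G" "torsion G g"
    and sep: "\<And>x. \<lbrakk>x \<in> powers G g; x \<noteq> \<one>\<rbrakk> \<Longrightarrow> separated G x"
  shows "virtual_retract_of (powers G g) G"
proof -
  have "finite (powers G g - {\<one>})" using torsion_finite_powers(1)[OF g(2,1)] by simp
  then obtain K where K: "finite_index K G" "K \<inter> (powers G g - {\<one>}) = {}"
    using finite_index_avoid_finite[of "powers G g - {\<one>}"] sep unfolding separated_def by blast
  obtain N where N: "finite_index N G" "N \<lhd> G" "N \<subseteq> K"
    by (rule finite_index_normal_core[OF K(1)])
  note sub = powers_subgroup[OF g(1)]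
  show ?thesis
  proof (rule virtual_retractI[OF sub(1) _ _ _ N(1)])
    show "subgroup N G" using N(1) by (simp add: finite_index_def)
    show "h \<otimes> n \<otimes> inv h \<in> N" if "h \<in> powers G g" "n \<in> N" for h n
      using N(2) that g by (auto intro: normal.inv_op_closed2)
    show "N \<inter> powers G g \<subseteq> {\<one>}" using K N by blast
    show "\<exists>h \<in> powers G g. x \<otimes> inv h \<in> N" if "x \<in> N" for x
      using that N(1) subgroup.one_closed[OF sub(1)] subgroup.mem_carrier[of N G x]
      by (intro bexI[of _ \<one>]) (auto simp: finite_index_def)
  qed
qed

text \<open>Averaging \<open>\<phi>\<close> over the conjugates by \<open>g\<close> makes it \<open>g\<close>-invariant, so that \<open>\<langle>g\<rangle>\<close> normalises
  the kernel of the average \<open>\<sigma>\<close>; this kernel is a complement of \<open>\<langle>g\<rangle>\<close> in a subgroup of finite index.\<close>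

lemma detected_virtual_retract:
  assumes g: "g \<in> carrier G" and det: "detected G g"
  shows "virtual_retract_of (powers G g) G"
proof -
  obtain K \<phi> n where K: "finite_index K G" and \<phi>: "\<phi> \<in> hom (G\<lparr>carrier := K\<rparr>) integer_group"
    and n: "g [^] (n::nat) \<in> K" "\<phi> (g [^] n) \<noteq> 0"
    using det unfolding detected_def by blast
  obtain N where N: "finite_index N G" "N \<lhd> G" "N \<subseteq> K"
    by (rule finite_index_normal_core[OF K])
  obtain m :: nat where m: "m > 0" "g [^] m \<in> N" by (rule finite_index_pow[OF N(1) g])
  have sK: "subgroup K G" and sN: "subgroup N G" using K N by (auto simp: finite_index_def)
  interpret N: subgroup N G by fact
  have gK: "group (G\<lparr>carrier := K\<rparr>)" and gN: "group (G\<lparr>carrier := N\<rparr>)"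
    using sK sN by (auto intro: subgroup_imp_group)
  have mult: "\<phi> (x \<otimes> y) = \<phi> x + \<phi> y" if "x \<in> K" "y \<in> K" for x y
    using \<phi> that by (simp add: hom_def)
  have pow: "\<phi> (x [^] (k::nat)) = int k * \<phi> x" if "x \<in> K" for x k
    using hom_pow_integer_group(1)[OF gK \<phi>] that by (simp add: nat_pow_def)
  \<comment> \<open>Both sides are the value of \<open>\<phi>\<close> at \<open>g\<close> to the
    power \<open>m n\<close>, so nonvanishing passes from exponent \<open>n\<close> to exponent
    \<open>m\<close>.\<close>
  have "int m * \<phi> (g [^] n) = int n * \<phi> (g [^] m)"
    using pow[OF n(1), of m] pow[of "g [^] m" n] m N g by (auto simp: nat_pow_pow mult.commute)
  then have gm: "\<phi> (g [^] m) \<noteq> 0" using m(1) n(2) by auto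
  have conj: "h \<otimes> x \<otimes> inv h \<in> N" if "h \<in> carrier G" "x \<in> N" for h x
    using N(2) that by (rule normal.inv_op_closed2)
  \<comment> \<open>Conjugation by elements of \<open>K\<close> leaves \<open>\<phi>\<close>
    unchanged, and \<open>g [^] m\<close> lies in \<open>K\<close>. The summands therefore repeat
    with period \<open>m\<close>, and one period is enough for the average.\<close>
  define \<sigma> where "\<sigma> x = (\<Sum>i<m. \<phi> (g [^] i \<otimes> x \<otimes> inv (g [^] i)))" for x
  have \<sigma>: "\<sigma> \<in> hom (G\<lparr>carrier := N\<rparr>) integer_group"
  proof (rule homI)
    fix x y assume "x \<in> carrier (G\<lparr>carrier := N\<rparr>)" "y \<in> carrier (G\<lparr>carrier := N\<rparr>)"
    then have xy: "x \<in> N" "y \<in> N" by simp_all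
    have "\<phi> (g [^] i \<otimes> (x \<otimes> y) \<otimes> inv (g [^] i))
        = \<phi> (g [^] i \<otimes> x \<otimes> inv (g [^] i)) + \<phi> (g [^] i \<otimes> y \<otimes> inv (g [^] i))" for i :: nat
    proof -
      have "g [^] i \<otimes> (x \<otimes> y) \<otimes> inv (g [^] i)
          = (g [^] i \<otimes> x \<otimes> inv (g [^] i)) \<otimes> (g [^] i \<otimes> y \<otimes> inv (g [^] i))"
        using xy g by (simp add: word_simps)
      then show ?thesis
        using mult[of "g [^] i \<otimes> x \<otimes> inv (g [^] i)" "g [^] i \<otimes> y \<otimes> inv (g [^] i)"]
          conj[of "g [^] i" x] conj[of "g [^] i" y] xy g N(3) by auto
    qed
    then show "\<sigma> (x \<otimes>\<^bsub>G\<lparr>carrier := N\<rparr>\<^esub> y) = \<sigma> x \<otimes>\<^bsub>integer_group\<^esub> \<sigma> y"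
      by (simp add: \<sigma>_def sum.distrib)
  qed simp
  have \<sigma>_mult: "\<sigma> (x \<otimes> y) = \<sigma> x + \<sigma> y" if "x \<in> N" "y \<in> N" for x y
    using \<sigma> that by (simp add: hom_def)
  have \<sigma>_inv: "\<sigma> (inv x) = - \<sigma> x" if "x \<in> N" for x
    using subgroup_hom_preimage(2)[OF sN _ \<sigma>] group.subgroup_self[OF group_integer_group] that by auto
  have \<sigma>_pow: "\<sigma> (x [^] (k::int)) = k * \<sigma> x" if "x \<in> N" for x k
    using hom_pow_integer_group(2)[OF gN \<sigma>, of x k] int_pow_consistent[OF sN that] that by simp
  have \<sigma>_conj: "\<sigma> (g \<otimes> x \<otimes> inv g) = \<sigma> x" if x: "x \<in> N" for x
  proof -
    define t where "t i = \<phi> (g [^] i \<otimes> x \<otimes> inv (g [^] i))" for i :: nat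
    have "g [^] i \<otimes> (g \<otimes> x \<otimes> inv g) \<otimes> inv (g [^] i) = g [^] Suc i \<otimes> x \<otimes> inv (g [^] Suc i)" for i :: nat
      using g x by (simp add: word_simps)
    then have "\<sigma> (g \<otimes> x \<otimes> inv g) = (\<Sum>i<m. t (Suc i))" by (simp add: \<sigma>_def t_def)
    \<comment> \<open>Conjugation by \<open>g\<close> shifts the index, so only the end terms
      \<open>t 0\<close> and \<open>t m\<close> have to be compared.\<close>
    also have "t 0 + \<dots> = (\<Sum>i<m. t i) + t m"
      by (metis sum.lessThan_Suc sum.lessThan_Suc_shift)
    also have "t m = t 0"
    proof -
      have *: "g [^] m \<in> K" "x \<in> K" "inv (g [^] m) \<in> K" "\<phi> (inv (g [^] m)) = - \<phi> (g [^] m)"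
        using m x N(3) subgroup.m_inv_closed[OF sK]
          subgroup_hom_preimage(2)[OF sK _ \<phi>] group.subgroup_self[OF group_integer_group] by auto
      then show ?thesis
        using subgroup.m_closed[OF sK] x by (simp add: t_def mult)
    qed
    finally show ?thesis by (simp add: \<sigma>_def t_def)
  qed
  have \<sigma>_conj_pow: "\<sigma> (g [^] j \<otimes> x \<otimes> inv (g [^] j)) = \<sigma> x" if x: "x \<in> N" for x and j :: int
  proof -
    have nat: "\<sigma> (g [^] k \<otimes> x \<otimes> inv (g [^] k)) = \<sigma> x" if "x \<in> N" for x and k :: nat
      using that
    proof (induction k arbitrary: x)
      case (Suc k)
      have "g [^] Suc k \<otimes> x \<otimes> inv (g [^] Suc k) = g [^] k \<otimes> (g \<otimes> x \<otimes> inv g) \<otimes> inv (g [^] k)"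
        using g Suc.prems by (simp add: word_simps)
      then show ?case using Suc.IH[OF conj[OF g Suc.prems]] \<sigma>_conj[OF Suc.prems] by simp
    qed simp
    show ?thesis
    proof (cases "j \<ge> 0")
      case True
      then show ?thesis using nat[OF x, of "nat j"] by (simp flip: int_pow_int)
    next
      case False
      let ?k = "nat (- j)"
      have j: "g [^] j = inv (g [^] ?k)" using False g by (simp add: int_pow_neg flip: int_pow_int)
      have "g [^] ?k \<otimes> (inv (g [^] ?k) \<otimes> x \<otimes> inv (inv (g [^] ?k))) \<otimes> inv (g [^] ?k) = x"
        using g x by (simp add: word_simps)
      then show ?thesis
        unfolding j using nat[OF conj, of "inv (g [^] ?k)" x ?k] g x by simp
    qed
  qed
  define s where "s = \<sigma> (g [^] m)"
  have "g [^] i \<otimes> g [^] m \<otimes> inv (g [^] i) = g [^] m" for i :: nat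
  proof -
    have "g [^] i \<otimes> g [^] m = g [^] m \<otimes> g [^] i" using g by (simp add: nat_pow_mult add.commute)
    then show ?thesis using g by (simp add: m_assoc)
  qed
  \<comment> \<open>All conjugates in the sum equal \<open>g [^] m\<close>, so \<open>s\<close> is
    \<open>m\<close> times \<open>\<phi> (g [^] m)\<close>.\<close>
  then have s: "s \<noteq> 0" using gm m by (simp add: s_def \<sigma>_def)
  \<comment> \<open>\<open>?C\<close> is the complement. On \<open>?M\<close> the map
    \<open>\<sigma>\<close> takes only values attained at powers of \<open>g [^] m\<close>, so
    division by such a power leads into \<open>?C\<close>.\<close>
  let ?C = "{x \<in> N. \<sigma> x \<in> {0}}"
  let ?M = "{x \<in> N. \<sigma> x \<in> {y. s dvd y}}"
  have "subgroup {0} integer_group" "subgroup {y. s dvd y} integer_group"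
    by (auto intro!: group.subgroupI[OF group_integer_group] intro: exI[of _ 0])
  then have sC: "subgroup ?C G" and sM: "subgroup ?M G"
    using subgroup_hom_preimage(1)[OF sN group_integer_group \<sigma>] by blast+
  have M: "finite_index ?M G"
  proof (rule finite_index_classI[OF N(1) sM, where q = "\<lambda>x. \<sigma> x mod \<bar>s\<bar>"])
    have "(\<lambda>x. \<sigma> x mod \<bar>s\<bar>) ` N \<subseteq> {0..<\<bar>s\<bar>}" using s by auto
    then show "finite ((\<lambda>x. \<sigma> x mod \<bar>s\<bar>) ` N)" by (rule finite_subset) simp
  next
    fix x y assume xy: "x \<in> N" "y \<in> N" "\<sigma> x mod \<bar>s\<bar> = \<sigma> y mod \<bar>s\<bar>"
    then have "s dvd \<sigma> x - \<sigma> y" by (metis abs_dvd_iff mod_eq_dvd_iff)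
    then show "x \<otimes> inv y \<in> ?M" using xy by (simp add: \<sigma>_mult \<sigma>_inv)
  qed
  note sub = powers_subgroup[OF g]
  show ?thesis
  proof (rule virtual_retractI[OF sub(1) sC _ _ M])
    show "h \<otimes> x \<otimes> inv h \<in> ?C" if "h \<in> powers G g" "x \<in> ?C" for h x
      using that \<sigma>_conj_pow conj[of h x] g by auto
    show "?C \<inter> powers G g \<subseteq> {\<one>}"
    proof
      fix x assume "x \<in> ?C \<inter> powers G g"
      then obtain j :: int where j: "x = g [^] j" "g [^] j \<in> N" "\<sigma> (g [^] j) = 0" by auto
      \<comment> \<open>Evaluating \<open>\<sigma>\<close> at \<open>g\<close> to the power
        \<open>j m\<close> in two ways gives \<open>m * 0 = j * s\<close>.\<close>
      have "(g [^] j) [^] int m = (g [^] m) [^] j"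
        using g by (simp add: int_pow_pow mult.commute flip: int_pow_int)
      then have "j * s = 0"
        using \<sigma>_pow[OF j(2), of "int m"] \<sigma>_pow[OF m(2), of j] j(3) by (simp add: s_def)
      then show "x \<in> {\<one>}" using s j by simp
    qed
    show "\<exists>h \<in> powers G g. x \<otimes> inv h \<in> ?C" if "x \<in> ?M" for x
    proof -
      have x: "x \<in> N" and "s dvd \<sigma> x" using that by auto
      then obtain c where c: "\<sigma> x = s * c" by (elim dvdE)
      have e: "(g [^] m) [^] c = g [^] (int m * c)"
        using g by (simp add: int_pow_pow flip: int_pow_int)
      have "g [^] (int m * c) \<in> N" "\<sigma> (g [^] (int m * c)) = s * c"
        using \<sigma>_pow[OF m(2), of c] subgroup_int_pow_closed[OF sN m(2), of c]
        by (simp_all add: e s_def)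
      then have "x \<otimes> inv (g [^] (int m * c)) \<in> ?C"
        using x c by (simp add: \<sigma>_mult \<sigma>_inv)
      then show ?thesis by blast
    qed
  qed
qed

text \<open>The kernel of the retraction onto the finite group of powers has finite index and misses
  \<open>g\<close>.\<close>

lemma virtual_retract_separated:
  assumes g: "g \<in> carrier G" "torsion G g" "g \<noteq> \<one>" and vr: "virtual_retract_of (powers G g) G"
  shows "separated G g"
proof -
  let ?H = "powers G g"
  obtain K \<rho> where K: "finite_index K G" "?H \<subseteq> K"
    and \<rho>: "\<rho> \<in> hom (G\<lparr>carrier := K\<rparr>) (G\<lparr>carrier := ?H\<rparr>)" "\<forall>h \<in> ?H. \<rho> h = h"
    using vr unfolding virtual_retract_of_def retract_of_def finite_index_def by auto
  note sub = powers_subgroup[OF g(1)]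
  interpret H: group "G\<lparr>carrier := ?H\<rparr>" using sub(1) by (rule subgroup_imp_group)
  have "finite_index {\<one>} (G\<lparr>carrier := ?H\<rparr>)"
    using H.finite_index_finite_carrier[OF _ H.triv_subgroup] torsion_finite_powers(1)[OF g(2,1)]
    by simp
  then have "finite_index {x \<in> K. \<rho> x \<in> {\<one>}} G"
    by (rule finite_index_hom_preimage[OF K(1) H.is_group \<rho>(1)])
  moreover have "\<rho> g = g" using \<rho>(2) sub(2) by blast
  ultimately show ?thesis using g(3) unfolding separated_def by auto
qed

text \<open>Identifying the infinite cyclic group of powers with the integers turns the retraction
  into a homomorphism with value 1 at \<open>g\<close>.\<close>

lemma virtual_retract_detected:
  assumes g: "g \<in> carrier G" "\<not> torsion G g" and vr: "virtual_retract_of (powers G g) G"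
  shows "detected G g"
proof -
  let ?H = "powers G g"
  obtain K \<rho> where K: "finite_index K G" "?H \<subseteq> K"
    and \<rho>: "\<rho> \<in> hom (G\<lparr>carrier := K\<rparr>) (G\<lparr>carrier := ?H\<rparr>)" "\<forall>h \<in> ?H. \<rho> h = h"
    using vr unfolding virtual_retract_of_def retract_of_def finite_index_def by auto
  define \<phi> where "\<phi> x = (THE j::int. \<rho> x = g [^] j)" for x
  have \<phi>: "\<phi> x = j" if "\<rho> x = g [^] j" for x j
    unfolding \<phi>_def using that int_pow_inject_nontorsion[OF g(2,1)] by auto
  have "\<phi> \<in> hom (G\<lparr>carrier := K\<rparr>) integer_group"
  proof (rule homI)
    fix x y assume xy: "x \<in> carrier (G\<lparr>carrier := K\<rparr>)" "y \<in> carrier (G\<lparr>carrier := K\<rparr>)"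
    then have "\<rho> x \<in> ?H" "\<rho> y \<in> ?H" using \<rho>(1) by (auto simp: hom_def)
    then obtain i j :: int where ij: "\<rho> x = g [^] i" "\<rho> y = g [^] j" by auto
    then have "\<rho> (x \<otimes> y) = g [^] (i + j)"
      using \<rho>(1) xy g by (simp add: hom_def int_pow_mult)
    then show "\<phi> (x \<otimes>\<^bsub>G\<lparr>carrier := K\<rparr>\<^esub> y) = \<phi> x \<otimes>\<^bsub>integer_group\<^esub> \<phi> y"
      using \<phi>[OF ij(1)] \<phi>[OF ij(2)] \<phi> by simp
  qed simp
  moreover have "g \<in> ?H" by (rule powers_subgroup(2)[OF g(1)])
  moreover from this have "\<rho> g = g" using \<rho>(2) by blast
  then have "\<phi> g = 1" using g by (intro \<phi>) simp
  ultimately have "g [^] (1::nat) \<in> K" "\<phi> (g [^] (1::nat)) \<noteq> 0" using K(2) g by auto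
  with \<open>\<phi> \<in> hom _ _\<close> K(1) show ?thesis unfolding detected_def by blast
qed

text \<open>This replaces retractions by conditions on single elements, which pull back along
  homomorphisms. The identity is an exception because it lies in every subgroup.\<close>

lemma VRC_iff:
  "VRC G \<longleftrightarrow> (\<forall>g \<in> carrier G. if torsion G g then g = \<one> \<or> separated G g else detected G g)"
proof
  assume "VRC G"
  then show "\<forall>g \<in> carrier G. if torsion G g then g = \<one> \<or> separated G g else detected G g"
    unfolding VRC_iff_powers by (auto intro: virtual_retract_separated virtual_retract_detected)
next
  assume *: "\<forall>g \<in> carrier G. if torsion G g then g = \<one> \<or> separated G g else detected G g"
  show "VRC G"
    unfolding VRC_iff_powers
  proof
    fix g assume g: "g \<in> carrier G"
    show "virtual_retract_of (powers G g) G"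
    proof (cases "torsion G g")
      case True
      then show ?thesis
        \<comment> \<open>Every power of a torsion element is torsion, so the hypothesis also
          separates all nontrivial powers of \<open>g\<close>.\<close>
        using * g torsion_finite_powers(2)[OF True g] subgroup.mem_carrier[OF powers_subgroup(1)[OF g]]
        by (intro torsion_virtual_retract) metis+
    next
      case False
      then show ?thesis using * g by (auto intro: detected_virtual_retract)
    qed
  qed
qed

lemma detected_separated:
  assumes g: "g \<in> carrier G" and det: "detected G g"
  shows "separated G g"
proof -
  obtain K \<phi> n where K: "finite_index K G" and \<phi>: "\<phi> \<in> hom (G\<lparr>carrier := K\<rparr>) integer_group"
    and n: "g [^] (n::nat) \<in> K" "\<phi> (g [^] n) \<noteq> 0"
    using det unfolding detected_def by blast
  \<comment> \<open>The factor 2 prevents \<open>s\<close> from dividing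
    \<open>\<phi> (g [^] n)\<close>, which is \<open>n\<close> times \<open>\<phi> g\<close> when
    \<open>g\<close> lies in \<open>K\<close>; hence \<open>s\<close> cannot divide
    \<open>\<phi> g\<close>.\<close>
  define s where "s = 2 * \<phi> (g [^] n)"
  have "finite_index {y. s dvd y} integer_group"
  proof (rule group.finite_index_classI[OF group_integer_group
        group.finite_index_carrier[OF group_integer_group], where q = "\<lambda>x. x mod \<bar>s\<bar>"])
    show "subgroup {y. s dvd y} integer_group"
      by (auto intro!: group.subgroupI[OF group_integer_group] intro: exI[of _ 0])
    have "(\<lambda>x. x mod \<bar>s\<bar>) ` carrier integer_group \<subseteq> {0..<\<bar>s\<bar>}" using n by (auto simp: s_def)
    then show "finite ((\<lambda>x. x mod \<bar>s\<bar>) ` carrier integer_group)" by (rule finite_subset) simp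
  qed (simp, metis abs_dvd_iff mod_eq_dvd_iff)
  then have "finite_index {x \<in> K. \<phi> x \<in> {y. s dvd y}} G" (is "finite_index ?L G")
    by (rule finite_index_hom_preimage[OF K group_integer_group \<phi>])
  moreover have "g \<notin> ?L"
  proof
    assume "g \<in> ?L"
    then have "g \<in> K" "s dvd \<phi> g" by auto
    moreover have "\<phi> (g [^] n) = int n * \<phi> g"
      using hom_pow_integer_group(1)[OF _ \<phi>, of g n] K \<open>g \<in> K\<close>
      by (simp add: finite_index_def nat_pow_def subgroup_imp_group)
    ultimately have "s dvd \<phi> (g [^] n)" by simp
    then show False using n(2) by (simp add: s_def)
  qed
  ultimately show ?thesis unfolding separated_def by blast
qed

text \<open>Nontorsion elements are separated because they are detected. This is residual
  finiteness.\<close>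

lemma VRC_separated:
  assumes "VRC G" "g \<in> carrier G" "g \<noteq> \<one>"
  shows "separated G g"
  using assms detected_separated unfolding VRC_iff by metis

end

section \<open>Wreath products\<close>

lemma torsion_hom:
  assumes "group G" "group H" "f \<in> hom G H" "g \<in> carrier G" "torsion G g"
  shows "torsion H (f g)"
proof -
  interpret f: group_hom G H f
    using assms by (simp add: group_hom_def group_hom_axioms_def)
  show ?thesis using assms(4,5) by (metis f.hom_nat_pow f.hom_one torsion_def)
qed

section \<open>Pulling the criteria back along homomorphisms\<close>

context group
begin

lemma torsion_pow:
  assumes "g \<in> carrier G" "m > 0" "torsion G (g [^] (m::nat))"
  shows "torsion G g"
proof -
  obtain n :: nat where "n > 0" "(g [^] m) [^] n = \<one>" using assms(3) by (auto simp: torsion_def)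
  then have "m * n > 0" "g [^] (m * n) = \<one>" using assms by (simp_all add: nat_pow_pow)
  then show ?thesis unfolding torsion_def by blast
qed

lemma detected_pow:
  assumes "g \<in> carrier G" "detected G (g [^] (m::nat))"
  shows "detected G g"
  using assms unfolding detected_def by (simp add: nat_pow_pow) blast

lemma separated_pullback:
  assumes "finite_index L G" "group A" "\<pi> \<in> hom (G\<lparr>carrier := L\<rparr>) A" "separated A (\<pi> g)"
  shows "separated G g"
proof -
  obtain D where D: "finite_index D A" "\<pi> g \<notin> D" using assms(4) by (auto simp: separated_def)
  have "finite_index {x \<in> L. \<pi> x \<in> D} G" by (rule finite_index_hom_preimage[OF assms(1-3) D(1)])
  then show ?thesis using D(2) unfolding separated_def by blast
qed

text \<open>Composing \<open>\<phi>\<close> with \<open>\<pi>\<close> on the preimage of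
  \<open>D\<close> detects the same power.\<close>

lemma detected_pullback:
  assumes L: "finite_index L G" and A: "group A" and \<pi>: "\<pi> \<in> hom (G\<lparr>carrier := L\<rparr>) A"
    and g: "g \<in> L" "detected A (\<pi> g)"
  shows "detected G g"
proof -
  obtain D \<phi> and n :: nat where D: "finite_index D A" and \<phi>: "\<phi> \<in> hom (A\<lparr>carrier := D\<rparr>) integer_group"
    and n: "\<pi> g [^]\<^bsub>A\<^esub> n \<in> D" "\<phi> (\<pi> g [^]\<^bsub>A\<^esub> n) \<noteq> 0"
    using g(2) unfolding detected_def by blast
  have sL: "subgroup L G" using L by (simp add: finite_index_def)
  interpret \<pi>: group_hom "G\<lparr>carrier := L\<rparr>" A \<pi>
    using A \<pi> sL by (simp add: group_hom_def group_hom_axioms_def subgroup_imp_group)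
  let ?K = "{x \<in> L. \<pi> x \<in> D}"
  have pow: "\<pi> (g [^] n) = \<pi> g [^]\<^bsub>A\<^esub> n" "g [^] n \<in> L"
    using \<pi>.hom_nat_pow[of g n] \<pi>.G.nat_pow_closed[of g n] g(1) by (simp_all add: nat_pow_def)
  have "finite_index ?K G" by (rule finite_index_hom_preimage[OF L A \<pi> D])
  moreover have "\<phi> \<circ> \<pi> \<in> hom (G\<lparr>carrier := ?K\<rparr>) integer_group"
    using \<pi> \<phi> by (simp add: hom_def)
  moreover have "g [^] n \<in> ?K" "(\<phi> \<circ> \<pi>) (g [^] n) \<noteq> 0" using n pow by simp_all
  ultimately show ?thesis unfolding detected_def by blast
qed

lemma hom_carrier_update: "hom (G\<lparr>carrier := carrier G\<rparr>) H = hom G H"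
  by (simp add: hom_def)

text \<open>Injectivity keeps nontrivial elements nontrivial and nontorsion elements nontorsion, so
  the criterion holds for \<open>f g\<close> and pulls back to \<open>g\<close>.\<close>

lemma VRC_inj_hom:
  assumes H: "group H" "VRC H" and f: "f \<in> hom G H" "inj_on f (carrier G)"
  shows "VRC G"
  unfolding VRC_iff
proof
  interpret f: group_hom G H f
    using H f by (simp add: group_hom_def group_hom_axioms_def)
  have one: "x = \<one>" if "f x = \<one>\<^bsub>H\<^esub>" "x \<in> carrier G" for x
    using f(2) that f.hom_one one_closed unfolding inj_on_def by metis
  note f' = f(1)[folded hom_carrier_update[of H]]
  fix g assume g: "g \<in> carrier G"
  then have fg: "f g \<in> carrier H" by simp
  show "if torsion G g then g = \<one> \<or> separated G g else detected G g"
  proof (cases "torsion G g")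
    case True
    then show ?thesis
      using separated_pullback[OF finite_index_carrier H(1) f', of g]
        group.VRC_separated[OF H fg] one g by auto
  next
    case False
    have "f (g [^] n) = f g [^]\<^bsub>H\<^esub> n" for n :: nat using g by (rule f.hom_nat_pow)
    then have "\<not> torsion H (f g)"
      using False one g unfolding torsion_def by (metis nat_pow_closed)
    then have "detected H (f g)" using H(2) fg unfolding group.VRC_iff[OF H(1)] by auto
    then show ?thesis
      using False detected_pullback[OF finite_index_carrier H(1) f' g] by simp
  qed
qed

end

text \<open>\<open>h\<close> maps the support of the composite bijectively onto the support of
  \<open>f\<close>. Both are infinite together, and for finite supports the usual reindexing
  applies.\<close>

lemma (in comm_monoid) gfinprod_reindex_bij:
  assumes h: "bij_betw h S S" and f: "f \<in> S \<rightarrow> carrier G"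
  shows "gfinprod G (\<lambda>y. f (h y)) S = gfinprod G f S"
proof -
  let ?T = "{y \<in> S. f y \<noteq> \<one>}" and ?U = "{y \<in> S. f (h y) \<noteq> \<one>}"
  have im: "h ` ?U = ?T" using h by (force simp: bij_betw_def)
  have inj: "inj_on h ?U" using h by (auto simp: bij_betw_def inj_on_def)
  have fin: "finite ?U \<longleftrightarrow> finite ?T" using finite_image_iff[OF inj] im by simp
  have "finprod G f (h ` ?U) = finprod G (\<lambda>y. f (h y)) ?U"
    using f im by (intro finprod_reindex inj) auto
  then show ?thesis by (simp only: gfinprod_def fin im)
qed

section \<open>Structure of the wreath product\<close>

locale wreath_product = A: group A + B: group B
  for A :: "('a, 'k) monoid_scheme" and B :: "('b, 'm) monoid_scheme"
begin

abbreviation "N \<equiv> base_group A B"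
abbreviation "W \<equiv> restricted_wreath A B"

sublocale N: group N by (rule group_base_group[OF A.is_group])
sublocale W: group W by (rule group_restricted_wreath[OF A.is_group B.is_group])

lemmas carrier_N = base_group_carrier[OF A.is_group, of B]

lemma wreath_simps:
  "carrier W = carrier N \<times> carrier B"
  "(f, b) \<otimes>\<^bsub>W\<^esub> (g, c) = (f \<otimes>\<^bsub>N\<^esub> base_action B b g, b \<otimes>\<^bsub>B\<^esub> c)"
  "\<one>\<^bsub>W\<^esub> = (\<one>\<^bsub>N\<^esub>, \<one>\<^bsub>B\<^esub>)"
  by (simp_all add: restricted_wreath_def semidirect_product_def)

lemma snd_hom: "snd \<in> hom W B"
  by (rule homI) (auto simp: wreath_simps)

lemma inl_hom: "(\<lambda>f. (f, \<one>\<^bsub>B\<^esub>)) \<in> hom N W"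
  by (rule homI) (auto simp: wreath_simps base_action_one[OF A.is_group B.is_group])

lemma inr_hom: "(\<lambda>b. (\<one>\<^bsub>N\<^esub>, b)) \<in> hom B W"
  using N.one_closed
  by (intro homI) (auto simp: wreath_simps base_action_def base_group_one base_group_mult)

lemma eval_hom: "x \<in> carrier B \<Longrightarrow> (\<lambda>f. f x) \<in> hom N A"
  by (rule homI) (auto simp: carrier_N base_group_mult)

lemma base_ext:
  assumes "f \<in> carrier N" "g \<in> carrier N" "\<And>x. x \<in> carrier B \<Longrightarrow> f x = g x"
  shows "f = g"
  using assms by (intro extensionalityI[of f "carrier B"]) (auto simp: carrier_N PiE_def)

section \<open>Sufficiency of the two conditions\<close>

lemma base_pow:
  assumes "f \<in> carrier N" "x \<in> carrier B"
  shows "(f [^]\<^bsub>N\<^esub> (n::nat)) x = f x [^]\<^bsub>A\<^esub> n"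
  using hom_nat_pow[OF eval_hom[OF assms(2)] assms(1)] N.is_group A.is_group by simp

text \<open>The support is finite, so the product of exponents killing its coordinates kills
  \<open>f\<close>. The contrapositive supplies a coordinate of infinite order.\<close>

lemma base_torsion:
  assumes f: "f \<in> carrier N" and tor: "\<And>x. x \<in> carrier B \<Longrightarrow> torsion A (f x)"
  shows "torsion W (f, \<one>\<^bsub>B\<^esub>)"
proof -
  let ?S = "{x \<in> carrier B. f x \<noteq> \<one>\<^bsub>A\<^esub>}"
  have fin: "finite ?S" and fA: "f \<in> carrier B \<rightarrow> carrier A" using f by (auto simp: carrier_N PiE_def)
  have "\<forall>x \<in> carrier B. \<exists>n::nat. n > 0 \<and> f x [^]\<^bsub>A\<^esub> n = \<one>\<^bsub>A\<^esub>"
    using tor by (simp add: torsion_def)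
  then obtain n :: "'b \<Rightarrow> nat"
    where n: "\<And>x. x \<in> carrier B \<Longrightarrow> n x > 0 \<and> f x [^]\<^bsub>A\<^esub> n x = \<one>\<^bsub>A\<^esub>" by metis
  define m where "m = prod n ?S"
  have "m > 0" unfolding m_def using n by (intro prod_pos) auto
  have "f x [^]\<^bsub>A\<^esub> m = \<one>\<^bsub>A\<^esub>" if x: "x \<in> carrier B" for x
  proof (cases "f x = \<one>\<^bsub>A\<^esub>")
    case False
    then have "n x dvd m" unfolding m_def using x fin by (intro dvd_prodI) auto
    then obtain k where "m = n x * k" by (elim dvdE)
    then have "f x [^]\<^bsub>A\<^esub> m = (f x [^]\<^bsub>A\<^esub> n x) [^]\<^bsub>A\<^esub> k"
      using fA x by (subst A.nat_pow_pow) auto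
    then show ?thesis using n[OF x] by simp
  qed simp
  then have "f [^]\<^bsub>N\<^esub> m = \<one>\<^bsub>N\<^esub>"
    using f by (intro base_ext) (simp_all add: base_pow, simp add: base_group_one)
  then have "torsion N f" using \<open>m > 0\<close> unfolding torsion_def by blast
  then show ?thesis by (rule torsion_hom[OF N.is_group W.is_group inl_hom f])
qed

text \<open>\<open>coord\<close> isolates what differs between finite \<open>B\<close> and abelian
  \<open>A\<close>: reading off one coordinate of one given \<open>f\<close> by a homomorphism,
  which may depend on both.\<close>

lemma VRC_wreathI:
  assumes VA: "VRC A" and VB: "VRC B"
    and coord: "\<And>f x. \<lbrakk>f \<in> carrier N; x \<in> carrier B\<rbrakk> \<Longrightarrow>
      \<exists>L \<pi>. finite_index L W \<and> \<pi> \<in> hom (W\<lparr>carrier := L\<rparr>) A \<and> (f, \<one>\<^bsub>B\<^esub>) \<in> L \<and> \<pi> (f, \<one>\<^bsub>B\<^esub>) = f x"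
  shows "VRC W"
  unfolding W.VRC_iff
proof
  note snd' = snd_hom[folded W.hom_carrier_update[of B]]
  fix g assume g: "g \<in> carrier W"
  then obtain f b where fb: "g = (f, b)" "f \<in> carrier N" "b \<in> carrier B" by (auto simp: wreath_simps)
  show "if torsion W g then g = \<one>\<^bsub>W\<^esub> \<or> separated W g else detected W g"
  proof (cases "torsion W g")
    case True
    have "separated W g" if "g \<noteq> \<one>\<^bsub>W\<^esub>"
    proof (cases "b = \<one>\<^bsub>B\<^esub>")
      case False
      then show ?thesis
        using W.separated_pullback[OF W.finite_index_carrier B.is_group snd', of g]
          B.VRC_separated[OF VB fb(3)] fb(1) by simp
    next
      case True
      then have "f \<noteq> \<one>\<^bsub>N\<^esub>" using that fb by (simp add: wreath_simps)
      then obtain x where x: "x \<in> carrier B" "f x \<noteq> \<one>\<^bsub>A\<^esub>"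
        using base_ext[OF fb(2) N.one_closed] by (auto simp: base_group_one)
      then have "separated A (f x)"
        using fb(2) by (intro A.VRC_separated[OF VA]) (auto simp: carrier_N)
      moreover obtain L \<pi> where "finite_index L W" "\<pi> \<in> hom (W\<lparr>carrier := L\<rparr>) A" "\<pi> g = f x"
        using coord[OF fb(2) x(1)] True fb(1) by auto
      ultimately show ?thesis using W.separated_pullback[of L A \<pi> g] A.is_group by simp
    qed
    then show ?thesis using True by auto
  next
    case False
    have "detected W g"
    proof (cases "torsion B b")
      case False
      then have "detected B b" using VB fb(3) unfolding B.VRC_iff by auto
      then show ?thesis
        using W.detected_pullback[OF W.finite_index_carrier B.is_group snd' g] fb(1) by simp
    next
      case True
      \<comment> \<open>The \<open>n\<close>-th power has trivial \<open>B\<close>-part, and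
        detecting a power of \<open>g\<close> is enough.\<close>
      then obtain n :: nat where n: "n > 0" "b [^]\<^bsub>B\<^esub> n = \<one>\<^bsub>B\<^esub>" by (auto simp: torsion_def)
      have gn: "g [^]\<^bsub>W\<^esub> n \<in> carrier W" using g by (rule W.nat_pow_closed)
      have "snd (g [^]\<^bsub>W\<^esub> n) = b [^]\<^bsub>B\<^esub> n"
        using hom_nat_pow[OF snd_hom g] W.is_group B.is_group fb(1) by simp
      then obtain f' where f': "g [^]\<^bsub>W\<^esub> n = (f', \<one>\<^bsub>B\<^esub>)" "f' \<in> carrier N"
        using gn n(2) by (auto simp: wreath_simps)
      have "\<not> torsion W (f', \<one>\<^bsub>B\<^esub>)" using W.torsion_pow[OF g n(1)] False f'(1) by auto
      then obtain x where x: "x \<in> carrier B" "\<not> torsion A (f' x)" using base_torsion f'(2) by blast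
      moreover have "f' x \<in> carrier A" using f'(2) x by (auto simp: carrier_N)
      ultimately have "detected A (f' x)" using VA unfolding A.VRC_iff by auto
      moreover obtain L \<pi> where "finite_index L W" "\<pi> \<in> hom (W\<lparr>carrier := L\<rparr>) A"
        "(f', \<one>\<^bsub>B\<^esub>) \<in> L" "\<pi> (f', \<one>\<^bsub>B\<^esub>) = f' x"
        using coord[OF f'(2) x(1)] by auto
      ultimately have "detected W (g [^]\<^bsub>W\<^esub> n)"
        using W.detected_pullback[of L A \<pi> "(f', \<one>\<^bsub>B\<^esub>)"] A.is_group f'(1) by simp
      then show ?thesis by (rule W.detected_pow[OF g])
    qed
    then show ?thesis using False by simp
  qed
qed

lemma finite_index_over:
  assumes "finite_index M B"
  shows "finite_index (carrier N \<times> M) W"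
proof -
  have "finite_index {w \<in> carrier W. snd w \<in> M} W"
    using snd_hom by (intro W.finite_index_hom_preimage[OF W.finite_index_carrier B.is_group _ assms])
      (simp add: W.hom_carrier_update)
  moreover have "{w \<in> carrier W. snd w \<in> M} = carrier N \<times> M"
    using assms subgroup.subset[of M B] by (auto simp: wreath_simps finite_index_def)
  ultimately show ?thesis by simp
qed

lemma VRC_wreath_finite:
  assumes "VRC A" "VRC B" "finite (carrier B)"
  shows "VRC W"
proof (rule VRC_wreathI[OF assms(1,2)])
  fix f x assume f: "f \<in> carrier N" and x: "x \<in> carrier B"
  have "finite_index {\<one>\<^bsub>B\<^esub>} B"
    using B.finite_index_finite_carrier[OF assms(3) B.triv_subgroup] .
  then have "finite_index (carrier N \<times> {\<one>\<^bsub>B\<^esub>}) W" by (rule finite_index_over)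
  \<comment> \<open>Elements of this subgroup have trivial \<open>B\<close>-part, so no shift occurs
    and evaluation is multiplicative.\<close>
  moreover have "(\<lambda>w. fst w x) \<in> hom (W\<lparr>carrier := carrier N \<times> {\<one>\<^bsub>B\<^esub>}\<rparr>) A"
    using eval_hom[OF x]
    by (intro homI) (auto simp: wreath_simps base_action_one[OF A.is_group B.is_group] hom_def)
  ultimately show "\<exists>L \<pi>. finite_index L W \<and> \<pi> \<in> hom (W\<lparr>carrier := L\<rparr>) A \<and>
      (f, \<one>\<^bsub>B\<^esub>) \<in> L \<and> \<pi> (f, \<one>\<^bsub>B\<^esub>) = f x"
    using f by (intro exI[of _ "carrier N \<times> {\<one>\<^bsub>B\<^esub>}"] exI[of _ "\<lambda>w. fst w x"]) auto
qed

text \<open>For abelian \<open>A\<close>, multiplying the values of \<open>f\<close> over a coset \<open>xM\<close> is invariant under the action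
  of \<open>M\<close>, and returns \<open>f x\<close> once \<open>xM\<close> meets the support of \<open>f\<close> at most in \<open>x\<close>.\<close>

lemma VRC_wreath_comm:
  assumes VA: "VRC A" and VB: "VRC B" and comm: "comm_group A"
  shows "VRC W"
proof (rule VRC_wreathI[OF VA VB])
  interpret A: comm_group A by fact
  fix f x assume f: "f \<in> carrier N" and x: "x \<in> carrier B"
  let ?S = "{y \<in> carrier B. f y \<noteq> \<one>\<^bsub>A\<^esub>}"
  \<comment> \<open>These are the quotients \<open>x^-1 y\<close> for support points
    \<open>y\<close> other than \<open>x\<close>. A subgroup \<open>M\<close> avoiding them has a
    coset \<open>x M\<close> that meets the support at most in \<open>x\<close>.\<close>
  let ?T = "(\<lambda>y. inv\<^bsub>B\<^esub> x \<otimes>\<^bsub>B\<^esub> y) ` ?S - {\<one>\<^bsub>B\<^esub>}"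
  have "finite ?T" using f by (auto simp: carrier_N)
  moreover have "\<exists>K. finite_index K B \<and> s \<notin> K" if "s \<in> ?T" for s
    using B.VRC_separated[OF VB, of s] that x unfolding separated_def by auto
  ultimately obtain M where M: "finite_index M B" "M \<inter> ?T = {}"
    using B.finite_index_avoid_finite[of ?T] by blast
  interpret M: subgroup M B using M by (simp add: finite_index_def)
  \<comment> \<open>A left coset is taken because the action translates arguments on the right, and
    right translation by \<open>M\<close> permutes \<open>C\<close>.\<close>
  define C where "C = (\<lambda>m. x \<otimes>\<^bsub>B\<^esub> m) ` M"
  have C: "C \<subseteq> carrier B" using x by (auto simp: C_def)
  \<comment> \<open>\<open>C\<close> may be infinite; \<open>gfinprod\<close> multiplies over the
    support only, which is finite for base elements.\<close>
  define \<pi> where "\<pi> w = gfinprod A (fst w) C" for w :: "('b \<Rightarrow> 'a) \<times> 'b"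
  have supp: "h \<in> C \<rightarrow> carrier A" "finite {y \<in> C. h y \<noteq> \<one>\<^bsub>A\<^esub>}" if "h \<in> carrier N" for h
    using that C by (auto simp: carrier_N elim!: rev_finite_subset)
  have "\<pi> \<in> hom (W\<lparr>carrier := carrier N \<times> M\<rparr>) A"
  proof (rule homI)
    fix v w assume "v \<in> carrier (W\<lparr>carrier := carrier N \<times> M\<rparr>)" "w \<in> carrier (W\<lparr>carrier := carrier N \<times> M\<rparr>)"
    then obtain h m h' m' where vw: "v = (h, m)" "w = (h', m')"
      and h: "h \<in> carrier N" "h' \<in> carrier N" and m: "m \<in> M" "m' \<in> M" by auto
    let ?h = "base_action B m h'"
    have h'': "?h \<in> carrier N"
      using base_action_closed[OF A.is_group B.is_group _ h(2)] m by simp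
    have "bij_betw (\<lambda>y. y \<otimes>\<^bsub>B\<^esub> m) C C"
    proof (rule bij_betwI[where g = "\<lambda>y. y \<otimes>\<^bsub>B\<^esub> inv\<^bsub>B\<^esub> m"])
      show "(\<lambda>y. y \<otimes>\<^bsub>B\<^esub> m) \<in> C \<rightarrow> C" "(\<lambda>y. y \<otimes>\<^bsub>B\<^esub> inv\<^bsub>B\<^esub> m) \<in> C \<rightarrow> C"
        using x m by (auto simp: C_def B.m_assoc)
    qed (use x m in \<open>auto simp: C_def B.m_assoc\<close>)
    then have "gfinprod A (\<lambda>y. h' (y \<otimes>\<^bsub>B\<^esub> m)) C = gfinprod A h' C"
      by (rule A.gfinprod_reindex_bij) (rule supp(1)[OF h(2)])
    moreover have "gfinprod A ?h C = gfinprod A (\<lambda>y. h' (y \<otimes>\<^bsub>B\<^esub> m)) C"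
      using supp(1)[OF h''] C by (intro A.gfinprod_cong) (auto simp: base_action_def simp_implies_def Pi_iff subset_iff)
    ultimately have inv: "gfinprod A ?h C = gfinprod A h' C" by simp
    have "gfinprod A (h \<otimes>\<^bsub>N\<^esub> ?h) C = gfinprod A (\<lambda>y. h y \<otimes>\<^bsub>A\<^esub> ?h y) C"
      using supp(1)[OF h(1)] supp(1)[OF h''] C
      by (intro A.gfinprod_cong) (auto simp: base_group_mult simp_implies_def Pi_iff subset_iff)
    also have "\<dots> = gfinprod A h C \<otimes>\<^bsub>A\<^esub> gfinprod A ?h C"
      using supp[OF h(1)] supp[OF h''] by (intro A.gfinprod_distrib) auto
    finally show "\<pi> (v \<otimes>\<^bsub>W\<lparr>carrier := carrier N \<times> M\<rparr>\<^esub> w) = \<pi> v \<otimes>\<^bsub>A\<^esub> \<pi> w"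
      using vw inv by (simp add: \<pi>_def wreath_simps)
  qed (use supp in \<open>auto simp: \<pi>_def intro: A.gfinprod_closed\<close>)
  moreover have "\<pi> (f, \<one>\<^bsub>B\<^esub>) = f x"
  proof -
    have "y = x" if y: "y \<in> C" "f y \<noteq> \<one>\<^bsub>A\<^esub>" for y
    proof -
      obtain m where m: "m \<in> M" "y = x \<otimes>\<^bsub>B\<^esub> m" using y(1) by (auto simp: C_def)
      then have "m = inv\<^bsub>B\<^esub> x \<otimes>\<^bsub>B\<^esub> y" using x by (simp add: B.inv_mult_cancel_left)
      then have "m = \<one>\<^bsub>B\<^esub>" using M(2) m that C by blast
      then show ?thesis using m x by simp
    qed
    moreover have "x \<in> C" using x by (auto simp: C_def intro: image_eqI[of _ _ "\<one>\<^bsub>B\<^esub>"])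
    ultimately have "gfinprod A f C = gfinprod A f {x}"
      using supp(1)[OF f] \<open>x \<in> C\<close>
      by (intro A.gfinprod_mono_neutral_cong_right) auto
    also have "\<dots> = f x" using f x by (simp add: carrier_N PiE_iff A.finprod_singleton)
    finally show ?thesis by (simp add: \<pi>_def)
  qed
  ultimately show "\<exists>L \<pi>. finite_index L W \<and> \<pi> \<in> hom (W\<lparr>carrier := L\<rparr>) A \<and>
      (f, \<one>\<^bsub>B\<^esub>) \<in> L \<and> \<pi> (f, \<one>\<^bsub>B\<^esub>) = f x"
    using finite_index_over[OF M(1)] f by (intro exI[of _ "carrier N \<times> M"] exI[of _ \<pi>]) auto
qed

section \<open>Necessity of the two conditions\<close>

definition single :: "'b \<Rightarrow> 'a \<Rightarrow> ('b \<Rightarrow> 'a) \<times> 'b" where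
  "single x a = ((\<lambda>y \<in> carrier B. if y = x then a else \<one>\<^bsub>A\<^esub>), \<one>\<^bsub>B\<^esub>)"

lemma single_hom:
  assumes "x \<in> carrier B"
  shows "single x \<in> hom A W" "inj_on (single x) (carrier A)"
proof -
  have cl: "(\<lambda>y \<in> carrier B. if y = x then a else \<one>\<^bsub>A\<^esub>) \<in> carrier N" if "a \<in> carrier A" for a
    using that finite_subset[of "{y \<in> carrier B. y = x \<and> a \<noteq> \<one>\<^bsub>A\<^esub>}" "{x}"]
    by (auto simp: carrier_N PiE_iff)
  show "single x \<in> hom A W"
  proof (rule homI)
    fix a a' assume "a \<in> carrier A" "a' \<in> carrier A"
    then show "single x (a \<otimes>\<^bsub>A\<^esub> a') = single x a \<otimes>\<^bsub>W\<^esub> single x a'"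
      using base_action_one[OF A.is_group B.is_group cl]
      by (auto simp: single_def wreath_simps base_group_mult fun_eq_iff restrict_def)
  qed (use cl in \<open>simp add: single_def wreath_simps\<close>)
  show "inj_on (single x) (carrier A)"
    using assms by (auto simp: inj_on_def single_def fun_eq_iff restrict_def split: if_splits)
qed

lemma single_commute:
  assumes "x \<noteq> y" "a \<in> carrier A" "a' \<in> carrier A" "x \<in> carrier B" "y \<in> carrier B"
  shows "single x a \<otimes>\<^bsub>W\<^esub> single y a' = single y a' \<otimes>\<^bsub>W\<^esub> single x a"
proof -
  have "single z c \<in> carrier W" if "z \<in> carrier B" "c \<in> carrier A" for z c
    using single_hom(1)[OF that(1)] that(2) by (auto simp: hom_def)
  then have "fst (single z c) \<in> carrier N" if "z \<in> carrier B" "c \<in> carrier A" for z c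
    using that by (simp add: wreath_simps mem_Times_iff)
  then have "base_action B \<one>\<^bsub>B\<^esub> (fst (single z c)) = fst (single z c)"
    if "z \<in> carrier B" "c \<in> carrier A" for z c
    using base_action_one[OF A.is_group B.is_group] that by blast
  from this[OF assms(4,2)] this[OF assms(5,3)] show ?thesis
    using assms by (auto simp: single_def wreath_simps base_group_mult fun_eq_iff restrict_def)
qed

text \<open>The conjugate is supported at the point \<open>y\<close> with \<open>y b = 1\<close>,
  hence the inverse of \<open>b\<close>.\<close>

lemma single_conj:
  assumes "b \<in> carrier B" "a \<in> carrier A"
  shows "(\<one>\<^bsub>N\<^esub>, b) \<otimes>\<^bsub>W\<^esub> single \<one>\<^bsub>B\<^esub> a \<otimes>\<^bsub>W\<^esub> inv\<^bsub>W\<^esub> (\<one>\<^bsub>N\<^esub>, b) = single (inv\<^bsub>B\<^esub> b) a"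
proof -
  let ?f = "\<lambda>y \<in> carrier B. if y = \<one>\<^bsub>B\<^esub> then a else \<one>\<^bsub>A\<^esub>"
  have "single \<one>\<^bsub>B\<^esub> a \<in> carrier W"
    using single_hom(1)[OF B.one_closed] assms(2) by (auto simp: hom_def)
  then have "?f \<in> carrier N" by (simp add: single_def wreath_simps)
  from restricted_wreath_conj[OF A.is_group B.is_group assms(1) this] show ?thesis
    using assms(1) by (auto simp: single_def fun_eq_iff restrict_def dest: B.inv_equality)
qed

lemma comm_group_if_VRC:
  assumes V: "VRC W" and inf: "infinite (carrier B)"
  shows "comm_group A"
proof (rule A.group_comm_groupI, rule ccontr)
  fix a a' assume a: "a \<in> carrier A" "a' \<in> carrier A" and ne: "a \<otimes>\<^bsub>A\<^esub> a' \<noteq> a' \<otimes>\<^bsub>A\<^esub> a"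
  note s = single_hom[OF B.one_closed]
  let ?u = "single \<one>\<^bsub>B\<^esub> a" and ?v = "single \<one>\<^bsub>B\<^esub> a'"
  have uv: "?u \<in> carrier W" "?v \<in> carrier W" using s(1) a by (auto simp: hom_def)
  \<comment> \<open>\<open>w\<close> is the commutator of \<open>?u\<close> and \<open>?v\<close>.
    Being nontrivial, it avoids some \<open>K\<close> of finite index; the contradiction comes from
    placing it in the normal core \<open>M\<close> of \<open>K\<close>.\<close>
  define w where "w = ?u \<otimes>\<^bsub>W\<^esub> ?v \<otimes>\<^bsub>W\<^esub> inv\<^bsub>W\<^esub> (?v \<otimes>\<^bsub>W\<^esub> ?u)"
  have w: "w \<in> carrier W" using uv by (simp add: w_def)
  have "w \<noteq> \<one>\<^bsub>W\<^esub>"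
  proof
    assume "w = \<one>\<^bsub>W\<^esub>"
    then have "?u \<otimes>\<^bsub>W\<^esub> ?v = ?v \<otimes>\<^bsub>W\<^esub> ?u"
      using uv by (metis w_def W.inv_closed W.inv_equality W.inv_inv W.m_closed)
    then have "single \<one>\<^bsub>B\<^esub> (a \<otimes>\<^bsub>A\<^esub> a') = single \<one>\<^bsub>B\<^esub> (a' \<otimes>\<^bsub>A\<^esub> a)"
      using s(1) a by (simp add: hom_def)
    then show False using ne inj_onD[OF s(2)] a by simp
  qed
  then obtain K where K: "finite_index K W" "w \<notin> K"
    using W.VRC_separated[OF V w] by (auto simp: separated_def)
  obtain M where M: "finite_index M W" "M \<lhd> W" "M \<subseteq> K"
    by (rule W.finite_index_normal_core[OF K(1)])
  have sM: "subgroup M W" using M by (simp add: finite_index_def)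
  interpret M: subgroup M W by fact
  have z: "(\<one>\<^bsub>N\<^esub>, b) \<in> carrier W" if "b \<in> carrier B" for b using that by (simp add: wreath_simps)
  \<comment> \<open>Infinitely many elements of \<open>B\<close> share finitely many cosets of
    \<open>M\<close>. Two in the same coset yield a nontrivial \<open>c\<close> whose copy
    \<open>?z\<close> lies in \<open>M\<close>.\<close>
  have "(\<lambda>b. M #>\<^bsub>W\<^esub> (\<one>\<^bsub>N\<^esub>, b)) ` carrier B \<subseteq> rcosets\<^bsub>W\<^esub> M"
    using z by (auto simp: RCOSETS_def)
  then have "\<not> inj_on (\<lambda>b. M #>\<^bsub>W\<^esub> (\<one>\<^bsub>N\<^esub>, b)) (carrier B)"
    using M(1) inf finite_subset finite_imageD unfolding finite_index_def by blast
  then obtain b b' where b: "b \<in> carrier B" "b' \<in> carrier B" "b \<noteq> b'"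
    and eq: "M #>\<^bsub>W\<^esub> (\<one>\<^bsub>N\<^esub>, b) = M #>\<^bsub>W\<^esub> (\<one>\<^bsub>N\<^esub>, b')"
    by (auto simp: inj_on_def)
  define c where "c = b \<otimes>\<^bsub>B\<^esub> inv\<^bsub>B\<^esub> b'"
  have c: "c \<in> carrier B" "inv\<^bsub>B\<^esub> c \<noteq> \<one>\<^bsub>B\<^esub>"
    using b by (auto simp: c_def B.inv_mult_group dest: B.inv_equality)
  interpret inr: group_hom B W "\<lambda>b. (\<one>\<^bsub>N\<^esub>, b)"
    using inr_hom by (simp add: group_hom_def group_hom_axioms_def)
  let ?z = "(\<one>\<^bsub>N\<^esub>, c)"
  have "?z = (\<one>\<^bsub>N\<^esub>, b) \<otimes>\<^bsub>W\<^esub> inv\<^bsub>W\<^esub> (\<one>\<^bsub>N\<^esub>, b')"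
    using b inr.hom_mult[of b "inv\<^bsub>B\<^esub> b'"] inr.hom_inv[of b'] by (simp add: c_def)
  then have zM: "?z \<in> M" using W.same_rcoset[OF sM z z] eq b by simp
  let ?u' = "single (inv\<^bsub>B\<^esub> c) a"
  have u': "?u' = ?z \<otimes>\<^bsub>W\<^esub> ?u \<otimes>\<^bsub>W\<^esub> inv\<^bsub>W\<^esub> ?z" using single_conj[OF c(1) a(1)] by simp
  \<comment> \<open>\<open>n\<close> is the commutator of \<open>?z\<close> and \<open>?u\<close>.
    It lies in \<open>M\<close> by normality, so \<open>?u\<close> and \<open>?u'\<close> agree
    modulo \<open>M\<close>.\<close>
  define n where "n = ?z \<otimes>\<^bsub>W\<^esub> (?u \<otimes>\<^bsub>W\<^esub> inv\<^bsub>W\<^esub> ?z \<otimes>\<^bsub>W\<^esub> inv\<^bsub>W\<^esub> ?u)"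
  have n: "n \<in> M" using zM normal.inv_op_closed2[OF M(2) uv(1)] by (simp add: n_def)
  then have nW: "n \<in> carrier W" by simp
  have zW: "?z \<in> carrier W" using zM by simp
  have nu: "n \<otimes>\<^bsub>W\<^esub> ?u = ?u'"
    unfolding u' n_def using uv zW by (simp add: W.word_simps)
  \<comment> \<open>The elements \<open>?u'\<close> and \<open>?v\<close> are supported at the
    distinct coordinates \<open>c^-1\<close> and \<open>1\<close>, so they commute.\<close>
  have "n \<otimes>\<^bsub>W\<^esub> ?u \<otimes>\<^bsub>W\<^esub> ?v = ?v \<otimes>\<^bsub>W\<^esub> (n \<otimes>\<^bsub>W\<^esub> ?u)"
    unfolding nu using c a by (intro single_commute) auto
  then have "inv\<^bsub>W\<^esub> n \<otimes>\<^bsub>W\<^esub> (n \<otimes>\<^bsub>W\<^esub> ?u \<otimes>\<^bsub>W\<^esub> ?v) \<otimes>\<^bsub>W\<^esub> inv\<^bsub>W\<^esub> (?v \<otimes>\<^bsub>W\<^esub> ?u)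
      = inv\<^bsub>W\<^esub> n \<otimes>\<^bsub>W\<^esub> (?v \<otimes>\<^bsub>W\<^esub> (n \<otimes>\<^bsub>W\<^esub> ?u)) \<otimes>\<^bsub>W\<^esub> inv\<^bsub>W\<^esub> (?v \<otimes>\<^bsub>W\<^esub> ?u)" by simp
  \<comment> \<open>Solving for \<open>u v = n^-1 v n u\<close> exhibits \<open>w\<close> as the
    inverse of \<open>n\<close> times a conjugate of \<open>n\<close>.\<close>
  then have "w = inv\<^bsub>W\<^esub> n \<otimes>\<^bsub>W\<^esub> (?v \<otimes>\<^bsub>W\<^esub> n \<otimes>\<^bsub>W\<^esub> inv\<^bsub>W\<^esub> ?v)"
    unfolding w_def using uv nW by (simp add: W.word_simps)
  then have "w \<in> M" using n normal.inv_op_closed2[OF M(2) uv(2) n] by simp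
  then show False using K M by blast
qed

lemma VRC_factors:
  assumes "VRC W"
  shows "VRC A" "VRC B"
  using A.VRC_inj_hom[OF W.is_group assms single_hom[OF B.one_closed]]
    B.VRC_inj_hom[OF W.is_group assms inr_hom] by (simp_all add: inj_on_def)

end

theorem theorem9p4:
  fixes A :: "('a, 'k) monoid_scheme" and B :: "('b, 'm) monoid_scheme"
  assumes "group A" and "group B"
  shows "VRC (restricted_wreath A B) \<longleftrightarrow>
    (VRC A \<and> VRC B) \<and> (finite (carrier B) \<or> comm_group A)"
proof -
  interpret wreath_product A B using assms by (simp add: wreath_product_def)
  show ?thesis
    using VRC_factors comm_group_if_VRC VRC_wreath_finite VRC_wreath_comm by blast
qed

end
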